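(* Let $f,g$ satisfy Assumption (CPSO) and let $(x^*,u^* )\in\mathcal M\times\Omega$ be a point at which (RPD-i), (RPD-ii) and (ND) hold. Let $\alpha_k\in[\underline\alpha,\overline\alpha]$ with $\alpha_k\to\alpha_*$ and $\beta_k\in[0,1]$ with $\beta_k\to\beta_*$, where $-\frac1{1+2\beta_*}<\lambda_{\min}(D_x\mathcal A_{\alpha_*}(x^*,u^* ))$. Assume that the iterates $x^{(k)}=x^{(k)}(u^* )$ of the accelerated proximal gradient algorithm (APG) with parameter $u^*$ converge to $x^*$ and that $(x^{(k)},x^{(k-1)},u^*,\alpha_k)\in V_{\alpha_*}$ for all $k\ge0$. Then for every $\dot u\in\mathcal U$ the sequence $(\dot x^{(k)}(u^* ))_{k\in\mathbb N}$ generated by forward mode automatic differentiation of APG converges to $D\psi(u^* )\dot u$, where $\psi$ is the local solution map around $u^*$.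
   Context: $\mathcal X,\mathcal U$ are finite-dimensional Euclidean spaces, $\mathcal M\subset\mathcal X$ is a $C^2$-smooth embedded submanifold, $\Omega\subset\mathcal U$ is open. $T_x\mathcal M$, $N_x\mathcal M=(T_x\mathcal M)^\perp$ are the tangent and normal spaces, $\Pi(x)$, $\Pi^\perp(x)$ the orthogonal projections onto them. A linear operator defined on a subspace is extended to the whole space by composing it with the orthogonal projection onto that subspace; $\dagger$ is the pseudoinverse; $\lambda_{\min}$ is the smallest eigenvalue (of an operator with real eigenvalues). Riemannian derivatives: for a function $h$ whose restriction to $\mathcal M$ is $C^2$ with $C^2$ extension $\tilde h$ near $x\in\mathcal M$, $\nabla_{\mathcal M}h(x)=\Pi(x)\nabla\tilde h(x)$ and $\nabla^2_{\mathcal M}h(x)=\Pi(x)\nabla^2\tilde h(x)+\mathfrak W_x(\cdot,\Pi^\perp(x)\nabla\tilde h(x))$ on $T_x\mathcal M$, where for $w\in N_x\mathcal M$ the Weingarten map $\mathfrak W_x(\cdot,w):T_x\mathcal M\to T_x\mathcal M$ is $v\mapsto-\Pi(x)\,\mathrm dW[v]$ with $W$ any local extension of $w$ to a normal vector field on $\mathcal M$. For $h(x,u)$, $\nabla_{\mathcal M}h,\nabla^2_{\mathcal M}h$ are taken in $x$ with $u$ fixed, and $D_u$ is the partial derivative in $u$. Partial smoothness: a proper lower semicontinuous $h$ is partly smooth at $x\in\mathcal M$ relative to $\mathcal M$ if $h$ is (Clarke/Rockafellar–Wets) regular at all points near $x$ and $\partial h(x)\ne\emptyset$; $\mathcal M$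 is a $C^2$ manifold and $h|_{\mathcal M}$ is $C^2$ around $x$; $N_x\mathcal M=\mathrm{par}\,\partial h(x)$ (subspace parallel to the affine hull); and $\partial h$ is continuous at $x$ relative to $\mathcal M$. It is partly smooth relative to $\mathcal M$ if this holds at every $x\in\mathcal M$. Assumption (CPSO): $f:\mathcal X\times\mathcal U\to\mathbb R$ is $C^2$; $g:\mathcal X\times\mathcal U\to\overline{\mathbb R}$ is partly smooth relative to $\mathcal M\times\Omega$; for each $u\in\Omega$, $f(\cdot,u)$ and $g(\cdot,u)$ are convex and $\nabla_xf(\cdot,u)$ is $L$-Lipschitz. $F:=f+g$; $\partial_x$ is the convex subdifferential in $x$. Conditions at a point $(x^*,u^* )\in\mathcal M\times\Omega$: (RPD-i) $\nabla^2_{\mathcal M}F(x^*,u^* )$ is positive definite on $T_{x^*}\mathcal M$; (RPD-ii) $\Pi(x^* )\nabla_x^2f(x^*,u^* )|_{T_{x^*}\mathcal M}$ is positive definite on $T_{x^*}\mathcal M$; (ND) $0\in\mathrm{ri}\,\partial_xF(x^*,u^* )$. Local solution map (known fact): if (CPSO) holds and (RPD-i), (ND) hold at $(x^*,u^* )$, there are an open neighbourhood $U\subset\Omega$ of $u^*$ and a $C^1$ map $\psi:U\to\mathcal M$ with $\psi(u^* )=x^*$ such that for all $u\in U$: $\psi(u)$ is the unique minimizer of $F(\cdot,u)|_{\mathcal M}$, (ND) and (RPD-i) hold at $(\psi(u),u)$, and $D\psi(u)=-\nabla^2_{\mathcal M}F(\psi(u),u)^\dagger D_u\nabla_{\mathcal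 M}F(\psi(u),u)$. Update maps: $0<\underline\alpha\le\overline\alpha<2/L$ are fixed; $P_{\alpha g}(w,u):=\arg\min_{x\in\mathcal X}\alpha g(x,u)+\tfrac12\|x-w\|^2$, $\mathcal A_\alpha(x,u):=P_{\alpha g}(x-\alpha\nabla_xf(x,u),u)$, and $\mathcal A_{\alpha,\beta}(x_1,x_2,u):=\big(\mathcal A_\alpha(x_1+\beta(x_1-x_2),u),\,x_1\big)$, with $z=(x_1,x_2)$. APG: starting from $x^{(0)}=x^{(-1)}\in\mathcal X$ (independent of $u$), with $z^{(k)}:=(x^{(k)},x^{(k-1)})$, iterate $z^{(k+1)}=\mathcal A_{\alpha_k,\beta_k}(z^{(k)},u)$, $k\ge0$. Forward mode AD of APG in direction $\dot u\in\mathcal U$: with $\dot z^{(k)}=(\dot x^{(k)},\dot x^{(k-1)})$ and $\dot z^{(0)}=0$, $\dot z^{(k+1)}=D_z\mathcal A_{\alpha_k,\beta_k}(z^{(k)},u)\dot z^{(k)}+D_u\mathcal A_{\alpha_k,\beta_k}(z^{(k)},u)\dot u$. The neighbourhood $V_{\alpha_*}$: under (CPSO) and (ND) at $(x^*,u^* )$, $V_{\alpha_*}\subset\mathcal X\times\mathcal X\times\Omega\times(0,2/L)$ denotes a neighbourhood of $(x^*,x^*,u^*,\alpha_* )$ on which, for every $\beta\in[0,1]$, $(z,u,\alpha)\mapsto\mathcal A_{\alpha,\beta}(z,u)$ is $C^1$ with values in $\mathcal M\times\mathcal X$, and $$D_z\mathcal A_{\alpha,\beta}(z,u)=\begin{bmatrix}(1+\beta)R&-\beta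 R\\ I&0\end{bmatrix},\quad D_u\mathcal A_{\alpha,\beta}(z,u)=\begin{bmatrix}S\\0\end{bmatrix},$$ $R=D_x\mathcal A_\alpha(x_1+\beta(x_1-x_2),u)$, $S=D_u\mathcal A_\alpha(x_1+\beta(x_1-x_2),u)$. Such a neighbourhood exists. *)

theory Defs
  imports "HOL-Analysis.Analysis"
begin

section \<open>Smooth maps, submanifolds and Riemannian derivatives\<close>

definition C1_on :: "'a::real_normed_vector set \<Rightarrow> ('a \<Rightarrow> 'b::real_normed_vector) \<Rightarrow> bool" where
  "C1_on S f \<longleftrightarrow> open S \<and>
    (\<exists>f' :: 'a \<Rightarrow> 'a \<Rightarrow>\<^sub>L 'b.
       (\<forall>x\<in>S. (f has_derivative blinfun_apply (f' x)) (at x)) \<and> continuous_on S f')"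

definition C2_on :: "'a::real_normed_vector set \<Rightarrow> ('a \<Rightarrow> 'b::real_normed_vector) \<Rightarrow> bool" where
  "C2_on S f \<longleftrightarrow>
    (\<exists>f' :: 'a \<Rightarrow> 'a \<Rightarrow>\<^sub>L 'b.
       (\<forall>x\<in>S. (f has_derivative blinfun_apply (f' x)) (at x)) \<and> C1_on S f')"

definition grad :: "('a::euclidean_space \<Rightarrow> real) \<Rightarrow> 'a \<Rightarrow> 'a" where
  "grad h x = (THE D. GDERIV h x :> D)"

definition hess :: "('a::euclidean_space \<Rightarrow> real) \<Rightarrow> 'a \<Rightarrow> 'a \<Rightarrow> 'a" where
  "hess h x = frechet_derivative (grad h) (at x)"

text \<open>Embedded submanifolds are described by straightening charts: around each of its points
  the set is mapped onto an open piece of a linear subspace by a \<open>C\<^sup>2\<close> diffeomorphism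
  between open subsets of the ambient space.\<close>

definition C2_submanifold :: "'a::euclidean_space set \<Rightarrow> bool" where
  "C2_submanifold M \<longleftrightarrow>
    (\<exists>d. \<forall>x\<in>M. \<exists>U V \<phi> \<phi>' (E :: 'a set).
       x \<in> U \<and> homeomorphism U V \<phi> \<phi>' \<and> C2_on U \<phi> \<and> C2_on V \<phi>' \<and>
       subspace E \<and> dim E = d \<and> \<phi> ` (U \<inter> M) = V \<inter> E)"

definition tangent_space :: "'a::euclidean_space set \<Rightarrow> 'a \<Rightarrow> 'a set" where
  "tangent_space M x =
    {v. \<exists>\<gamma> e. e > 0 \<and> C1_on {-e<..<e} \<gamma> \<and> \<gamma> ` {-e<..<e} \<subseteq> M \<and>
          \<gamma> (0::real) = x \<and> (\<gamma> has_vector_derivative v) (at 0)}"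

definition normal_space :: "'a::euclidean_space set \<Rightarrow> 'a \<Rightarrow> 'a set" where
  "normal_space M x = (tangent_space M x)\<^sup>\<bottom>"

definition orth_proj :: "'a::euclidean_space set \<Rightarrow> 'a \<Rightarrow> 'a" where
  "orth_proj S v = (THE p. p \<in> S \<and> v - p \<in> S\<^sup>\<bottom>)"

definition C2_extension_at ::
    "'a::euclidean_space set \<Rightarrow> ('a \<Rightarrow> ereal) \<Rightarrow> 'a \<Rightarrow> ('a \<Rightarrow> real) \<Rightarrow> bool" where
  "C2_extension_at M h x h' \<longleftrightarrow>
    (\<exists>U. x \<in> U \<and> C2_on U h' \<and> (\<forall>y\<in>U \<inter> M. h y = ereal (h' y)))"

text \<open>The following two choices are arbitrary; the Weingarten map, the Riemannian gradient and
  the Riemannian Hessian below do not depend on them (for \<open>x \<in> M\<close>, \<open>v\<close> tangent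
  and \<open>w\<close> normal).\<close>

definition C2_extension :: "'a::euclidean_space set \<Rightarrow> ('a \<Rightarrow> ereal) \<Rightarrow> 'a \<Rightarrow> 'a \<Rightarrow> real" where
  "C2_extension M h x = (SOME h'. C2_extension_at M h x h')"

definition normal_field :: "'a::euclidean_space set \<Rightarrow> 'a \<Rightarrow> 'a \<Rightarrow> 'a \<Rightarrow> 'a" where
  "normal_field M x w =
    (SOME W. W x = w \<and> (\<exists>U. x \<in> U \<and> C1_on U W \<and> (\<forall>y\<in>U \<inter> M. W y \<in> normal_space M y)))"

definition weingarten :: "'a::euclidean_space set \<Rightarrow> 'a \<Rightarrow> 'a \<Rightarrow> 'a \<Rightarrow> 'a" where
  "weingarten M x v w =
    - orth_proj (tangent_space M x) (frechet_derivative (normal_field M x w) (at x) v)"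

definition riem_grad :: "'a::euclidean_space set \<Rightarrow> ('a \<Rightarrow> ereal) \<Rightarrow> 'a \<Rightarrow> 'a" where
  "riem_grad M h x = orth_proj (tangent_space M x) (grad (C2_extension M h x) x)"

text \<open>The Riemannian Hessian is already extended to the whole space by precomposition with the
  projection onto the tangent space.\<close>

definition riem_hess :: "'a::euclidean_space set \<Rightarrow> ('a \<Rightarrow> ereal) \<Rightarrow> 'a \<Rightarrow> 'a \<Rightarrow> 'a" where
  "riem_hess M h x v =
    (let T = tangent_space M x; N = normal_space M x; h' = C2_extension M h x; t = orth_proj T v
     in orth_proj T (hess h' x t) + weingarten M x t (orth_proj N (grad h' x)))"


section \<open>Linear operators\<close>

definition positive_definite_on :: "'a::euclidean_space set \<Rightarrow> ('a \<Rightarrow> 'a) \<Rightarrow> bool" where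
  "positive_definite_on T A \<longleftrightarrow> (\<forall>v\<in>T. v \<noteq> 0 \<longrightarrow> v \<bullet> A v > 0)"

text \<open>Moore--Penrose pseudoinverse.\<close>

definition pinv :: "('a::euclidean_space \<Rightarrow> 'b::euclidean_space) \<Rightarrow> 'b \<Rightarrow> 'a" where
  "pinv A = (THE B. linear B \<and> A \<circ> B \<circ> A = A \<and> B \<circ> A \<circ> B = B \<and>
      adjoint (A \<circ> B) = A \<circ> B \<and> adjoint (B \<circ> A) = B \<circ> A)"

definition lambda_min :: "('a::euclidean_space \<Rightarrow> 'a) \<Rightarrow> real" where
  "lambda_min A = Min {l. \<exists>v. v \<noteq> 0 \<and> A v = l *\<^sub>R v}"


section \<open>Variational analysis\<close>

definition ereal_epigraph :: "('a \<Rightarrow> ereal) \<Rightarrow> ('a \<times> real) set" where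
  "ereal_epigraph h = {(x, r). h x \<le> ereal r}"

definition proper_fun :: "('a \<Rightarrow> ereal) \<Rightarrow> bool" where
  "proper_fun h \<longleftrightarrow> (\<forall>x. h x \<noteq> -\<infinity>) \<and> (\<exists>x. h x \<noteq> \<infinity>)"

definition lsc :: "('a::topological_space \<Rightarrow> ereal) \<Rightarrow> bool" where
  "lsc h \<longleftrightarrow> (\<forall>x. h x \<le> Liminf (at x) h)"

definition regular_normals :: "'a::euclidean_space set \<Rightarrow> 'a \<Rightarrow> 'a set" where
  "regular_normals C x =
    {v. \<forall>e>0. eventually (\<lambda>y. v \<bullet> (y - x) \<le> e * norm (y - x)) (at x within C)}"

definition limiting_normals :: "'a::euclidean_space set \<Rightarrow> 'a \<Rightarrow> 'a set" where
  "limiting_normals C x =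
    {v. \<exists>X V. (\<forall>k. X k \<in> C \<and> V k \<in> regular_normals C (X k)) \<and>
          X \<longlonglongrightarrow> x \<and> V \<longlonglongrightarrow> v}"

definition clarke_regular :: "'a::euclidean_space set \<Rightarrow> 'a \<Rightarrow> bool" where
  "clarke_regular C x \<longleftrightarrow>
    x \<in> C \<and> (\<exists>e>0. closed (C \<inter> cball x e)) \<and> limiting_normals C x = regular_normals C x"

definition subdifferentially_regular :: "('a::euclidean_space \<Rightarrow> ereal) \<Rightarrow> 'a \<Rightarrow> bool" where
  "subdifferentially_regular h x \<longleftrightarrow>
    \<bar>h x\<bar> \<noteq> \<infinity> \<and> clarke_regular (ereal_epigraph h) (x, real_of_ereal (h x))"

definition regular_subdiff :: "('a::euclidean_space \<Rightarrow> ereal) \<Rightarrow> 'a \<Rightarrow> 'a set" where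
  "regular_subdiff h x =
    {v. \<bar>h x\<bar> \<noteq> \<infinity> \<and>
        (\<forall>e>0. eventually (\<lambda>y. h y \<ge> h x + ereal (v \<bullet> (y - x) - e * norm (y - x))) (at x))}"

definition limiting_subdiff :: "('a::euclidean_space \<Rightarrow> ereal) \<Rightarrow> 'a \<Rightarrow> 'a set" where
  "limiting_subdiff h x =
    {v. \<bar>h x\<bar> \<noteq> \<infinity> \<and>
        (\<exists>X V. (\<forall>k. V k \<in> regular_subdiff h (X k)) \<and>
           X \<longlonglongrightarrow> x \<and> (\<lambda>k. h (X k)) \<longlonglongrightarrow> h x \<and> V \<longlonglongrightarrow> v)}"

definition convex_subdiff :: "('a::euclidean_space \<Rightarrow> ereal) \<Rightarrow> 'a \<Rightarrow> 'a set" where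
  "convex_subdiff h x = {v. \<bar>h x\<bar> \<noteq> \<infinity> \<and> (\<forall>y. h y \<ge> h x + ereal (v \<bullet> (y - x)))}"

definition parallel_subspace :: "'a::euclidean_space set \<Rightarrow> 'a set" where
  "parallel_subspace S = {a - b | a b. a \<in> affine hull S \<and> b \<in> affine hull S}"

text \<open>Outer and inner semicontinuity at \<open>x\<close> relative to \<open>M\<close>
  (Painleve--Kuratowski).\<close>

definition set_continuous_rel ::
    "'a::euclidean_space set \<Rightarrow> ('a \<Rightarrow> 'b::euclidean_space set) \<Rightarrow> 'a \<Rightarrow> bool" where
  "set_continuous_rel M S x \<longleftrightarrow>
    (\<forall>X V v. (\<forall>k. X k \<in> M \<and> V k \<in> S (X k)) \<and> X \<longlonglongrightarrow> x \<and> V \<longlonglongrightarrow> v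
        \<longrightarrow> v \<in> S x) \<and>
    (\<forall>v\<in>S x. \<forall>e>0. eventually (\<lambda>y. \<exists>w\<in>S y. dist w v < e) (at x within M))"

text \<open>Subdifferential regularity only makes sense where \<open>h\<close> is finite, so regularity
  at all points near \<open>x\<close> refers to the points of the domain near \<open>x\<close>.\<close>

definition partly_smooth_at ::
    "('a::euclidean_space \<Rightarrow> ereal) \<Rightarrow> 'a set \<Rightarrow> 'a \<Rightarrow> bool" where
  "partly_smooth_at h M x \<longleftrightarrow>
    x \<in> M \<and> proper_fun h \<and> lsc h \<and>
    (\<exists>e>0. \<forall>y\<in>ball x e. \<bar>h y\<bar> \<noteq> \<infinity> \<longrightarrow> subdifferentially_regular h y) \<and>
    limiting_subdiff h x \<noteq> {} \<and>
    C2_submanifold M \<and> (\<exists>h'. C2_extension_at M h x h') \<and>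
    normal_space M x = parallel_subspace (limiting_subdiff h x) \<and>
    set_continuous_rel M (limiting_subdiff h) x"

definition partly_smooth :: "('a::euclidean_space \<Rightarrow> ereal) \<Rightarrow> 'a set \<Rightarrow> bool" where
  "partly_smooth h M \<longleftrightarrow> (\<forall>x\<in>M. partly_smooth_at h M x)"


section \<open>The parametric problem\<close>

definition objective :: "('x \<times> 'u \<Rightarrow> real) \<Rightarrow> ('x \<times> 'u \<Rightarrow> ereal) \<Rightarrow> 'x \<times> 'u \<Rightarrow> ereal" where
  "objective f g p = ereal (f p) + g p"

definition CPSO ::
    "('x::euclidean_space \<times> 'u::euclidean_space \<Rightarrow> real) \<Rightarrow> ('x \<times> 'u \<Rightarrow> ereal) \<Rightarrow>
     'x set \<Rightarrow> 'u set \<Rightarrow> real \<Rightarrow> bool" where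
  "CPSO f g M \<Omega> L \<longleftrightarrow>
    C2_on UNIV f \<and> partly_smooth g (M \<times> \<Omega>) \<and>
    (\<forall>u\<in>\<Omega>. convex_on UNIV (\<lambda>x. f (x, u)) \<and>
            convex (ereal_epigraph (\<lambda>x. g (x, u))) \<and>
            L-lipschitz_on UNIV (grad (\<lambda>x. f (x, u))))"

definition RPD_i ::
    "('x::euclidean_space \<times> 'u::euclidean_space \<Rightarrow> real) \<Rightarrow> ('x \<times> 'u \<Rightarrow> ereal) \<Rightarrow>
     'x set \<Rightarrow> 'x \<Rightarrow> 'u \<Rightarrow> bool" where
  "RPD_i f g M x u \<longleftrightarrow>
    positive_definite_on (tangent_space M x) (riem_hess M (\<lambda>y. objective f g (y, u)) x)"

definition RPD_ii ::
    "('x::euclidean_space \<times> 'u::euclidean_space \<Rightarrow> real) \<Rightarrow> 'x set \<Rightarrow> 'x \<Rightarrow> 'u \<Rightarrow> bool" where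
  "RPD_ii f M x u \<longleftrightarrow>
    positive_definite_on (tangent_space M x)
      (\<lambda>v. orth_proj (tangent_space M x) (hess (\<lambda>y. f (y, u)) x v))"

definition ND ::
    "('x::euclidean_space \<times> 'u::euclidean_space \<Rightarrow> real) \<Rightarrow> ('x \<times> 'u \<Rightarrow> ereal) \<Rightarrow>
     'x \<Rightarrow> 'u \<Rightarrow> bool" where
  "ND f g x u \<longleftrightarrow> 0 \<in> rel_interior (convex_subdiff (\<lambda>y. objective f g (y, u)) x)"

definition local_solution_map ::
    "('x::euclidean_space \<times> 'u::euclidean_space \<Rightarrow> real) \<Rightarrow> ('x \<times> 'u \<Rightarrow> ereal) \<Rightarrow>
     'x set \<Rightarrow> 'u set \<Rightarrow> 'x \<Rightarrow> 'u \<Rightarrow> 'u set \<Rightarrow> ('u \<Rightarrow> 'x) \<Rightarrow> bool" where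
  "local_solution_map f g M \<Omega> xs us U \<psi> \<longleftrightarrow>
    open U \<and> us \<in> U \<and> U \<subseteq> \<Omega> \<and> C1_on U \<psi> \<and> \<psi> ` U \<subseteq> M \<and> \<psi> us = xs \<and>
    (\<forall>u\<in>U.
       (\<forall>x. is_arg_min (\<lambda>y. objective f g (y, u)) (\<lambda>y. y \<in> M) x \<longleftrightarrow> x = \<psi> u) \<and>
       ND f g (\<psi> u) u \<and> RPD_i f g M (\<psi> u) u \<and>
       frechet_derivative \<psi> (at u) =
         (\<lambda>v. - pinv (riem_hess M (\<lambda>y. objective f g (y, u)) (\<psi> u))
               (frechet_derivative
                  (\<lambda>u'. riem_grad M (\<lambda>y. objective f g (y, u')) (\<psi> u)) (at u) v)))"


section \<open>Accelerated proximal gradient and its forward mode derivative\<close>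

definition prox :: "real \<Rightarrow> ('x::euclidean_space \<Rightarrow> ereal) \<Rightarrow> 'x \<Rightarrow> 'x" where
  "prox \<alpha> h w = (ARG_MIN (\<lambda>x. ereal \<alpha> * h x + ereal (1 / 2 * (norm (x - w))\<^sup>2)) x. True)"

definition pg_map ::
    "('x::euclidean_space \<times> 'u \<Rightarrow> real) \<Rightarrow> ('x \<times> 'u \<Rightarrow> ereal) \<Rightarrow> real \<Rightarrow> 'x \<Rightarrow> 'u \<Rightarrow> 'x" where
  "pg_map f g \<alpha> x u = prox \<alpha> (\<lambda>y. g (y, u)) (x - \<alpha> *\<^sub>R grad (\<lambda>y. f (y, u)) x)"

definition extrapolate :: "real \<Rightarrow> 'x::real_vector \<times> 'x \<Rightarrow> 'x" where
  "extrapolate \<beta> z = fst z + \<beta> *\<^sub>R (fst z - snd z)"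

definition apg_map ::
    "('x::euclidean_space \<times> 'u \<Rightarrow> real) \<Rightarrow> ('x \<times> 'u \<Rightarrow> ereal) \<Rightarrow> real \<Rightarrow> real \<Rightarrow>
     'x \<times> 'x \<Rightarrow> 'u \<Rightarrow> 'x \<times> 'x" where
  "apg_map f g \<alpha> \<beta> z u = (pg_map f g \<alpha> (extrapolate \<beta> z) u, fst z)"

text \<open>The \<open>k\<close>-th term is the pair of the \<open>k\<close>-th and the \<open>(k-1)\<close>-st iterate.\<close>

primrec apg ::
    "('x::euclidean_space \<times> 'u \<Rightarrow> real) \<Rightarrow> ('x \<times> 'u \<Rightarrow> ereal) \<Rightarrow>
     (nat \<Rightarrow> real) \<Rightarrow> (nat \<Rightarrow> real) \<Rightarrow> 'x \<Rightarrow> 'u \<Rightarrow> nat \<Rightarrow> 'x \<times> 'x" where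
  "apg f g \<alpha> \<beta> x0 u 0 = (x0, x0)"
| "apg f g \<alpha> \<beta> x0 u (Suc k) = apg_map f g (\<alpha> k) (\<beta> k) (apg f g \<alpha> \<beta> x0 u k) u"

primrec apg_forward_ad ::
    "('x::euclidean_space \<times> 'u::euclidean_space \<Rightarrow> real) \<Rightarrow> ('x \<times> 'u \<Rightarrow> ereal) \<Rightarrow>
     (nat \<Rightarrow> real) \<Rightarrow> (nat \<Rightarrow> real) \<Rightarrow> 'x \<Rightarrow> 'u \<Rightarrow> 'u \<Rightarrow> nat \<Rightarrow> 'x \<times> 'x" where
  "apg_forward_ad f g \<alpha> \<beta> x0 u du 0 = 0"
| "apg_forward_ad f g \<alpha> \<beta> x0 u du (Suc k) =
     frechet_derivative (\<lambda>z. apg_map f g (\<alpha> k) (\<beta> k) z u) (at (apg f g \<alpha> \<beta> x0 u k))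
       (apg_forward_ad f g \<alpha> \<beta> x0 u du k) +
     frechet_derivative (\<lambda>u'. apg_map f g (\<alpha> k) (\<beta> k) (apg f g \<alpha> \<beta> x0 u k) u') (at u) du"

definition apg_neighbourhood ::
    "('x::euclidean_space \<times> 'u::euclidean_space \<Rightarrow> real) \<Rightarrow> ('x \<times> 'u \<Rightarrow> ereal) \<Rightarrow>
     'x set \<Rightarrow> 'u set \<Rightarrow> real \<Rightarrow> 'x \<Rightarrow> 'u \<Rightarrow> real \<Rightarrow> (('x \<times> 'x) \<times> 'u \<times> real) set \<Rightarrow> bool" where
  "apg_neighbourhood f g M \<Omega> L xs us as V \<longleftrightarrow>
    open V \<and> ((xs, xs), us, as) \<in> V \<and> V \<subseteq> UNIV \<times> \<Omega> \<times> {0<..<2 / L} \<and>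
    (\<forall>\<beta>\<in>{0..1}.
       C1_on V (\<lambda>(z, u, \<alpha>). apg_map f g \<alpha> \<beta> z u) \<and>
       (\<forall>z u \<alpha>. (z, u, \<alpha>) \<in> V \<longrightarrow>
          (let R = frechet_derivative (\<lambda>x. pg_map f g \<alpha> x u) (at (extrapolate \<beta> z));
               S = frechet_derivative (\<lambda>u'. pg_map f g \<alpha> (extrapolate \<beta> z) u') (at u)
           in apg_map f g \<alpha> \<beta> z u \<in> M \<times> UNIV \<and>
              frechet_derivative (\<lambda>z'. apg_map f g \<alpha> \<beta> z' u) (at z) =
                (\<lambda>(h1, h2). ((1 + \<beta>) *\<^sub>R R h1 - \<beta> *\<^sub>R R h2, h1)) \<and>
              frechet_derivative (\<lambda>u'. apg_map f g \<alpha> \<beta> z u') (at u) = (\<lambda>h. (S h, 0)))))"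

end

(*
  Along the convergent iterates, forward mode AD is a linear iteration in R^(2n) whose operators
  tend to T (h1, h2) = ((1 + b) R h1 - b R h2, h1), where R is the derivative of the proximal
  gradient map at (xs, us). Every point (psi u, u) is a fixed point of the proximal gradient map by
  (ND); differentiating, the derivative of psi gives the fixed point of the limiting affine
  iteration. A perturbation argument leaves T^n z -> 0 to be shown.

  Let B = I - alpha H be the derivative of the gradient step, with H the Hessian of f in x.
  The proximal map is a firmly nonexpansive gradient field, so the form <B a, R b> is symmetric,
  dominates |R a|^2, and makes R self-adjoint. The range of R is tangent to the manifold, where
  (RPD-ii) makes H positive definite; hence <B R a, R a> < |R a|^2 unless R a = 0. Together with
  the lower bound on the eigenvalues of R this gives a Lyapunov function for T which is quadratic
  in the sum and the difference of two consecutive iterates.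
*)

theory Submission
  imports Defs
begin

section \<open>Eigenvalues and the two-step linear iteration\<close>

text \<open>On an eigenvector of \<open>R\<close> with eigenvalue r, the recursion behind T has the
  characteristic polynomial p(t) = t^2 - (1 + b) r t + b r. Its roots lie in the open unit disc iff
  p(1) = 1 - r, p(-1) = 1 + (1 + 2 b) r and 1 - b r are all positive. The threshold -1 / (1 + 2 b)
  comes from p(-1), and the Lyapunov function has the same origin: p(1) weights the squared sum,
  p(-1) the squared difference, and 1 - b r the decrease per step. The decrease is a quadratic form
  in the change over two steps, and this form vanishes on ker R, so it does not give convergence by
  itself. It shows that R x changes less and less over two steps; a 2-periodic limit is excluded
  because 1 and -1 are not roots. A further obstacle is regularity: only the proximal map composed
  with the gradient step is known to be differentiable, so the symmetry of R has to come from a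
  potential of the proximal map and not from factoring R through B.\<close>

lemma eigenvectors_independent:
  fixes A :: "'a::euclidean_space \<Rightarrow> 'a"
  assumes "linear A" "finite S" "\<And>l. l \<in> S \<Longrightarrow> e l \<noteq> 0 \<and> A (e l) = l *\<^sub>R e l"
    "(\<Sum>l\<in>S. c l *\<^sub>R e l) = 0" "l \<in> S"
  shows "c l = 0"
  using assms(2-)
proof (induction S arbitrary: c l rule: finite_induct)
  case empty
  then show ?case by simp
next
  case (insert m S)
  have E: "c m *\<^sub>R e m + (\<Sum>l\<in>S. c l *\<^sub>R e l) = 0"
    using insert by simp
  have "A (c m *\<^sub>R e m + (\<Sum>l\<in>S. c l *\<^sub>R e l)) = 0"
    using E linear_0[OF assms(1)] by simp
  then have "c m *\<^sub>R m *\<^sub>R e m + (\<Sum>l\<in>S. c l *\<^sub>R l *\<^sub>R e l) = 0"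
    using insert.prems(1)
    by (simp add: linear_add[OF assms(1)] linear_sum[OF assms(1)] linear_scale[OF assms(1)])
  moreover have "m *\<^sub>R c m *\<^sub>R e m + (\<Sum>l\<in>S. m *\<^sub>R c l *\<^sub>R e l) = 0"
    using arg_cong[OF E, of "\<lambda>x. m *\<^sub>R x"] by (simp add: scaleR_add_right scaleR_sum_right)
  ultimately have "(\<Sum>l\<in>S. c l *\<^sub>R l *\<^sub>R e l) - (\<Sum>l\<in>S. m *\<^sub>R c l *\<^sub>R e l) = 0"
    by (simp add: eq_neg_iff_add_eq_0[symmetric] mult.commute add_eq_0_iff)
  then have "(\<Sum>l\<in>S. (c l * (l - m)) *\<^sub>R e l) = 0"
    by (simp add: sum_subtractf[symmetric] algebra_simps)
  then have *: "\<And>l. l \<in> S \<Longrightarrow> c l * (l - m) = 0"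
    using insert.IH[of "\<lambda>l. c l * (l - m)"] insert.prems(1) by blast
  have S0: "\<And>l. l \<in> S \<Longrightarrow> c l = 0"
  proof -
    fix l assume "l \<in> S"
    then show "c l = 0" using *[of l] insert.hyps(2) by auto
  qed
  then have "c m *\<^sub>R e m = 0" using E by simp
  then have "c m = 0" using insert.prems(1) by simp
  then show ?case using S0 insert.prems by auto
qed

text \<open>\<open>lambda_min\<close> is a \<open>Min\<close>, which bounds its members from below
  only for a finite set. Too many eigenvalues would give more independent eigenvectors than the
  dimension allows.\<close>

lemma finite_eigenvalues:
  fixes A :: "'a::euclidean_space \<Rightarrow> 'a"
  assumes "linear A"
  shows "finite {l. \<exists>v. v \<noteq> 0 \<and> A v = l *\<^sub>R v}" (is "finite ?L")
proof (rule ccontr)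
  assume "infinite ?L"
  then obtain S where S: "S \<subseteq> ?L" "finite S" "card S = Suc DIM('a)"
    using infinite_arbitrarily_large by blast
  define e where "e l = (SOME v. v \<noteq> 0 \<and> A v = l *\<^sub>R v)" for l
  have e: "e l \<noteq> 0 \<and> A (e l) = l *\<^sub>R e l" if "l \<in> S" for l
    unfolding e_def by (rule someI_ex) (use S(1) that in blast)
  have inj: "inj_on e S"
  proof (rule inj_onI)
    fix l m assume "l \<in> S" "m \<in> S" "e l = e m"
    then show "l = m" using e[of l] e[of m] by (metis scaleR_cancel_right)
  qed
  have "independent (e ` S)"
  proof (rule independent_if_scalars_zero)
    show "finite (e ` S)" using S by simp
    fix f x assume "(\<Sum>x\<in>e ` S. f x *\<^sub>R x) = 0" "x \<in> e ` S"
    then obtain l where l: "l \<in> S" "x = e l" and "(\<Sum>l\<in>S. f (e l) *\<^sub>R e l) = 0"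
      using inj by (auto simp: sum.reindex)
    then show "f x = 0"
      using eigenvectors_independent[OF assms S(2) e, of "\<lambda>l. f (e l)"] by blast
  qed
  then have "card (e ` S) \<le> DIM('a)" by (rule independent_bound[THEN conjunct2])
  then show False using inj S by (simp add: card_image)
qed

text \<open>The constant is the minimum of the form over the compact unit sphere of
  \<open>S\<close>. It turns the strict inequality of (RPD-ii) into a uniform gap.\<close>

lemma pos_on_subspace_imp_coercive:
  fixes S :: "'a::euclidean_space set"
  assumes "subspace S" "linear Q" "\<And>s. s \<in> S \<Longrightarrow> s \<noteq> 0 \<Longrightarrow> 0 < Q s \<bullet> s"
  obtains c where "0 < c" "\<And>s. s \<in> S \<Longrightarrow> c * (s \<bullet> s) \<le> Q s \<bullet> s"
proof (cases "S \<subseteq> {0}")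
  case True
  then have "1 * (s \<bullet> s) \<le> Q s \<bullet> s" if "s \<in> S" for s
    using that by auto
  then show ?thesis using that[of 1] by simp
next
  case False
  then obtain v where v: "v \<in> S" "v \<noteq> 0" by auto
  let ?K = "S \<inter> sphere 0 1"
  have "compact ?K" using closed_subspace[OF assms(1)] by (simp add: closed_Int_compact)
  moreover have "v /\<^sub>R norm v \<in> ?K" using v assms(1) by (simp add: subspace_scale)
  then have "?K \<noteq> {}" by blast
  moreover have "continuous_on ?K (\<lambda>s. Q s \<bullet> s)"
    using assms(2)
    by (intro continuous_on_inner continuous_on_id linear_continuous_on)
       (simp add: linear_conv_bounded_linear)
  ultimately obtain m where m: "m \<in> ?K" "\<And>s. s \<in> ?K \<Longrightarrow> Q m \<bullet> m \<le> Q s \<bullet> s"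
    using continuous_attains_inf by meson
  have "0 < Q m \<bullet> m" using m(1) assms(3) by fastforce
  moreover have "(Q m \<bullet> m) * (s \<bullet> s) \<le> Q s \<bullet> s" if "s \<in> S" for s
  proof (cases "s = 0")
    case False
    then have "Q m \<bullet> m \<le> Q (s /\<^sub>R norm s) \<bullet> (s /\<^sub>R norm s)"
      using that assms(1) by (intro m(2)) (simp add: subspace_scale)
    also have "\<dots> = (Q s \<bullet> s) / (norm s)\<^sup>2"
      by (simp add: linear_scale[OF assms(2)] power2_eq_square divide_inverse)
    finally show ?thesis using False by (simp add: dot_square_norm field_simps)
  qed simp
  ultimately show ?thesis using that by blast
qed

text \<open>Along \<open>x + t y\<close> the form is \<open>2 t b + t^2 c\<close>; this stays
  nonnegative near \<open>t = 0\<close> only if \<open>b = 0\<close>.\<close>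

lemma psd_form_null:
  fixes Q :: "'a::real_inner \<Rightarrow> 'a"
  assumes "linear Q" "\<And>x y. Q x \<bullet> y = Q y \<bullet> x" "\<And>x. 0 \<le> Q x \<bullet> x" "Q x \<bullet> x = 0"
  shows "Q x = 0"
proof -
  have "Q x \<bullet> y = 0" for y
  proof (rule ccontr)
    assume n: "Q x \<bullet> y \<noteq> 0"
    have q: "0 \<le> 2 * t * (Q x \<bullet> y) + t\<^sup>2 * (Q y \<bullet> y)" for t :: real
      using assms(3)[of "x + t *\<^sub>R y"] assms(4) assms(2)[of y x]
      by (simp add: linear_add[OF assms(1)] linear_scale[OF assms(1)] inner_add_left
          inner_add_right power2_eq_square algebra_simps)
    define b c where "b = Q x \<bullet> y" and "c = Q y \<bullet> y"
    have "0 \<le> c" unfolding c_def by (rule assms(3))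
    \<comment> \<open>The minimizing parameter is \<open>- b / c\<close>; the denominator
      \<open>c + 1\<close> also covers \<open>c = 0\<close> and still makes the value
      negative.\<close>
    define r where "r = 1 / (c + 1)"
    have r: "0 < r" "r * c \<le> 1" using \<open>0 \<le> c\<close> by (simp_all add: r_def field_simps)
    have "0 \<le> 2 * (- b * r) * b + (- b * r)\<^sup>2 * c"
      using q[of "- b * r"] by (simp add: b_def c_def)
    also have "\<dots> = (b\<^sup>2 * r) * (r * c - 2)"
      by (simp add: algebra_simps power2_eq_square)
    also have "\<dots> < 0"
      by (rule mult_pos_neg) (use n r in \<open>simp_all add: b_def\<close>)
    finally show False by simp
  qed
  then show ?thesis by (metis inner_eq_zero_iff)
qed

text \<open>\<open>R\<close> is the derivative of the proximal gradient map and \<open>B\<close> the derivative of the gradient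
  step. The form \<open>B a \<bullet> R b\<close> is symmetric positive semidefinite with kernel \<open>ker R\<close>, and \<open>R\<close> is
  self-adjoint for it; this replaces diagonalisation, since \<open>B\<close> may be singular or indefinite.\<close>

locale prox_grad_linearization =
  fixes R B :: "'a::euclidean_space \<Rightarrow> 'a" and c :: real
  assumes linR: "linear R" and linB: "linear B"
    and symB: "\<And>x y. B x \<bullet> y = x \<bullet> B y"
    and symBR: "\<And>x y. B x \<bullet> R y = B y \<bullet> R x"
    and firm: "\<And>s. R s \<bullet> R s \<le> B s \<bullet> R s"
    and c_pos: "0 < c"
    and gap: "\<And>s. B (R s) \<bullet> R s \<le> (1 - c) * (R s \<bullet> R s)"
begin

lemmas R_simps = linear_add[OF linR] linear_diff[OF linR] linear_scale[OF linR] linear_0[OF linR]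
lemmas B_simps = linear_add[OF linB] linear_diff[OF linB] linear_scale[OF linB] linear_0[OF linB]

lemma BR_linear: "linear (\<lambda>s. B (R s))"
  using linear_compose[OF linR linB] by (simp add: o_def)

lemma BR_sym: "B (R x) \<bullet> y = B (R y) \<bullet> x"
  using symBR[of x y] symB[of "R x" y] symB[of "R y" x] by (simp add: inner_commute)

text \<open>Self-adjointness of \<open>R\<close> for the form \<open>B (R x) \<bullet> y\<close>:
  both sides reduce to \<open>B (R x) \<bullet> R y\<close>.\<close>

lemma BRR_sym: "B (R (R x)) \<bullet> y = B (R (R y)) \<bullet> x"
  using BR_sym[of "R x" y] BR_sym[of "R y" x] symB[of "R x" "R y"] by (simp add: inner_commute)

lemma BR_nonneg: "0 \<le> B (R s) \<bullet> s" "R s \<bullet> R s \<le> B (R s) \<bullet> s"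
  using firm[of s] inner_ge_zero[of "R s"] symB[of "R s" s] inner_commute[of "R s" "B s"]
  by linarith+

lemma BR_null: "B (R x) = 0 \<Longrightarrow> R x = 0"
  using BR_nonneg(2)[of x] by (metis inner_eq_zero_iff inner_ge_zero inner_zero_left order_antisym)

text \<open>A Rayleigh quotient argument for the form \<open>B (R x) \<bullet> x\<close>. As this
  form vanishes on \<open>ker R\<close>, the quotient is minimized over the orthogonal complement
  \<open>P\<close> of the kernel, where the form is positive. The minimum \<open>m\<close> is an
  eigenvalue of \<open>R\<close>, hence above \<open>- 1 / k\<close>.\<close>

lemma shifted_form_nonneg:
  assumes k: "0 < k" and ev: "\<And>l v. v \<noteq> 0 \<Longrightarrow> R v = l *\<^sub>R v \<Longrightarrow> - 1 / k < l"
  shows "0 \<le> B (R s) \<bullet> s + k * (B (R (R s)) \<bullet> s)"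
proof -
  define N where "N = {x. R x = 0}"
  define P where "P = {x. \<forall>y\<in>N. orthogonal y x}"
  have sN: "subspace N" unfolding N_def by (rule linear_subspace_kernel[OF linR])
  have sP: "subspace P"
    unfolding P_def by (auto simp: subspace_def orthogonal_def inner_add_right)
  have pos: "0 < B (R x) \<bullet> x" if "x \<in> P" "x \<noteq> 0" for x
  proof -
    have "x \<notin> N" using that unfolding P_def orthogonal_def by force
    then have "0 < R x \<bullet> R x" unfolding N_def by simp
    then show ?thesis using BR_nonneg(2)[of x] by linarith
  qed
  define q where "q m x = B (R (R x)) \<bullet> x - m * (B (R x) \<bullet> x)" for m x
  have ex: "\<exists>n\<in>N. \<exists>p\<in>P. x = n + p" for x
  proof -
    obtain n p where np: "n \<in> span N" "\<And>w. w \<in> span N \<Longrightarrow> orthogonal p w" "x = n + p"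
      using orthogonal_subspace_decomp_exists[of N x] by metis
    then have "n \<in> N" "p \<in> P"
      using sN by (auto simp: span_eq_iff[THEN iffD2, OF sN] P_def orthogonal_commute)
    then show ?thesis using np(3) by blast
  qed
  \<comment> \<open>By symmetry every cross term contains \<open>R n = 0\<close>, so inequalities
    proved on \<open>P\<close> extend to the whole space.\<close>
  have mod: "q m (n + p) = q m p" if "n \<in> N" for m n p
  proof -
    have "B (R p) \<bullet> n = B (R n) \<bullet> p" "B (R (R p)) \<bullet> n = B (R (R n)) \<bullet> p"
      by (rule BR_sym, rule BRR_sym)
    then show ?thesis using that
      by (simp add: q_def N_def R_simps B_simps inner_add_right)
  qed
  show ?thesis
  proof (cases "P \<subseteq> {0}")
    case True
    then have "R s = 0" using ex[of s] by (auto simp: N_def)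
    then show ?thesis by (simp add: R_simps B_simps)
  next
    case False
    then obtain v where v: "v \<in> P" "v \<noteq> 0" by auto
    let ?K = "P \<inter> sphere 0 1"
    let ?f = "\<lambda>x. (B (R (R x)) \<bullet> x) / (B (R x) \<bullet> x)"
    have "compact ?K" using closed_subspace[OF sP] by (simp add: closed_Int_compact)
    have "v /\<^sub>R norm v \<in> ?K" using v sP by (simp add: subspace_scale)
    then have "?K \<noteq> {}" by blast
    have "\<And>x. x \<in> ?K \<Longrightarrow> B (R x) \<bullet> x \<noteq> 0" using pos by fastforce
    moreover have "linear (\<lambda>x. B (R (R x)))"
      using linear_compose[OF linR BR_linear] by (simp add: o_def)
    ultimately have "continuous_on ?K ?f"
      using BR_linear
      by (intro continuous_on_divide continuous_on_inner continuous_on_id linear_continuous_on)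
         (auto simp: linear_conv_bounded_linear)
    from continuous_attains_inf[OF \<open>compact ?K\<close> \<open>?K \<noteq> {}\<close> this]
    obtain w where w: "w \<in> ?K" "\<forall>s\<in>?K. ?f w \<le> ?f s" by (elim bexE)
    define m where "m = ?f w"
    have wp: "0 < B (R w) \<bullet> w" using w(1) pos by fastforce
    have qP: "0 \<le> q m p" if "p \<in> P" for p
    proof (cases "p = 0")
      case True
      then show ?thesis by (simp add: q_def)
    next
      case False
      then have "m \<le> ?f (p /\<^sub>R norm p)"
        unfolding m_def using that sP by (intro w(2)[rule_format]) (simp add: subspace_scale)
      also have "\<dots> = ?f p" using False by (simp add: R_simps B_simps)
      finally show ?thesis using pos[OF that False] by (simp add: q_def field_simps)
    qed
    then have qnn: "0 \<le> q m x" for x using ex[of x] mod by auto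
    \<comment> \<open>The operator of the semidefinite form \<open>q m\<close>. The minimizer
      \<open>w\<close> is a null vector of the form, so \<open>Q w = 0\<close>; this says
      \<open>R w = m w\<close> only modulo \<open>ker R\<close>, and the eigenvector is therefore
      \<open>R w\<close>, not \<open>w\<close>.\<close>
    define Q where "Q x = B (R (R x - m *\<^sub>R x))" for x
    have qQ: "Q x \<bullet> x = q m x" for x
      by (simp add: Q_def q_def R_simps B_simps inner_diff_left)
    have "Q w = 0"
    proof (rule psd_form_null[of Q])
      show "linear Q"
        by (rule linearI) (simp_all add: Q_def R_simps B_simps algebra_simps)
      show "Q x \<bullet> y = Q y \<bullet> x" for x y
        using BR_sym[of x y] BRR_sym[of x y] by (simp add: Q_def R_simps B_simps inner_diff_left)
      show "0 \<le> Q x \<bullet> x" for x using qnn qQ by simp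
      show "Q w \<bullet> w = 0" using wp by (simp add: qQ q_def m_def)
    qed
    then have "R (R w) = m *\<^sub>R R w"
      using BR_null[of "R w - m *\<^sub>R w"] by (simp add: Q_def R_simps)
    moreover have "R w \<noteq> 0" using wp by (auto simp: B_simps)
    ultimately have "- 1 / k < m" using ev by blast
    then have "- 1 \<le> k * m" using k by (simp add: field_simps)
    then have "- 1 * (B (R s) \<bullet> s) \<le> (k * m) * (B (R s) \<bullet> s)"
      using BR_nonneg(1) by (rule mult_right_mono)
    also have "\<dots> \<le> k * (B (R (R s)) \<bullet> s)"
      using qnn[of s] k by (simp add: q_def mult.assoc)
    finally show ?thesis by simp
  qed
qed

text \<open>Excludes the eigenvalue 1: on a fixed vector, \<open>firm\<close> and \<open>gap\<close>
  bound the same quantity \<open>B v \<bullet> v\<close> from both sides.\<close>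

lemma fixed_point_zero: "R v = v \<Longrightarrow> v = 0"
proof -
  assume "R v = v"
  then have "v \<bullet> v \<le> B v \<bullet> v" "B v \<bullet> v \<le> (1 - c) * (v \<bullet> v)"
    using firm[of v] gap[of v] by simp_all
  then have "c * (v \<bullet> v) \<le> 0" by (simp add: algebra_simps)
  then have "v \<bullet> v \<le> 0" using c_pos by (simp add: mult_le_0_iff)
  then show "v = 0" by (metis inner_eq_zero_iff inner_ge_zero order_antisym)
qed

text \<open>Telescoping the Lyapunov function \<open>W\<close> makes the decreases
  \<open>D (e n)\<close> summable, so \<open>R (e n)\<close> tends to 0. Up to vanishing terms, two
  consecutive steps then form a stationary linear system for \<open>R x\<close>, whose only solution
  is 0.\<close>

lemma two_step_converges:
  fixes \<beta> :: real and x :: "nat \<Rightarrow> 'a"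
  assumes b: "0 \<le> \<beta>" "\<beta> \<le> 1"
    and ev: "\<And>l v. v \<noteq> 0 \<Longrightarrow> R v = l *\<^sub>R v \<Longrightarrow> - 1 / (1 + 2 * \<beta>) < l"
    and rec: "\<And>n. x (Suc (Suc n)) = R ((1 + \<beta>) *\<^sub>R x (Suc n) - \<beta> *\<^sub>R x n)"
  shows "x \<longlonglongrightarrow> 0"
proof -
  define k where "k = 1 + 2 * \<beta>"
  have k: "0 < k" using b by (simp add: k_def)
  define Ph where "Ph a b = B (R a) \<bullet> b" for a b
  have Ph_sym: "Ph a b = Ph b a" for a b unfolding Ph_def by (rule BR_sym)
  have PhR: "Ph (R a) b = Ph a (R b)" for a b
    using BR_sym[of "R a" b] symB[of "R b" "R a"] by (simp add: Ph_def inner_commute)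
  have Ph_lin: "Ph (a + a') b = Ph a b + Ph a' b" "Ph (a - a') b = Ph a b - Ph a' b"
    "Ph (t *\<^sub>R a) b = t * Ph a b" "Ph a (b + b') = Ph a b + Ph a b'" "Ph a (b - b') = Ph a b - Ph a b'"
    "Ph a (t *\<^sub>R b) = t * Ph a b" for a a' b b' t
    by (simp_all add: Ph_def R_simps B_simps inner_add_left inner_add_right inner_diff_left
        inner_diff_right)
  \<comment> \<open>\<open>1 - R\<close> and \<open>1 + k R\<close> are the values of the
    characteristic polynomial at 1 and -1, as operators in the form \<open>Ph\<close>. The first
    part is nonnegative by \<open>upper\<close>, the second by
    \<open>shifted_form_nonneg\<close>.\<close>
  define W where "W a b = (1/2) * (Ph (a + b) (a + b) - Ph (R (a + b)) (a + b))
     + (1/2) * (Ph (a - b) (a - b) + k * Ph (R (a - b)) (a - b))" for a b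
  define D where "D e = Ph e e - \<beta> * Ph (R e) e" for e
  have upper: "Ph (R e) e \<le> Ph e e - c * (R e \<bullet> R e)" for e
  proof -
    have "Ph (R e) e = B (R e) \<bullet> R e" unfolding Ph_def by (rule BR_sym)
    then show ?thesis
      using gap[of e] BR_nonneg(2)[of e] unfolding Ph_def by (simp add: algebra_simps)
  qed
  have W_nonneg: "0 \<le> W a b" for a b
  proof -
    have "0 \<le> Ph (a + b) (a + b) - Ph (R (a + b)) (a + b)"
      using upper[of "a + b"] c_pos by (smt (verit) inner_ge_zero mult_nonneg_nonneg)
    moreover have "0 \<le> Ph (a - b) (a - b) + k * Ph (R (a - b)) (a - b)"
      unfolding Ph_def by (rule shifted_form_nonneg[OF k]) (use ev in \<open>simp add: k_def\<close>)
    ultimately show ?thesis by (simp add: W_def)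
  qed
  \<comment> \<open>\<open>D e\<close> is the convex combination, with weights
    \<open>1 - \<beta>\<close> and \<open>\<beta>\<close>, of \<open>Ph e e\<close> and
    \<open>Ph e e - Ph (R e) e\<close>. These are at least 1 and \<open>c\<close> times
    \<open>R e \<bullet> R e\<close>, so the minimum serves every \<open>\<beta>\<close>.\<close>
  define d where "d = min 1 c"
  have d: "0 < d" "d \<le> 1" "d \<le> c" using c_pos by (auto simp: d_def)
  have D_lower: "d * (R e \<bullet> R e) \<le> D e" for e
  proof -
    have ee: "R e \<bullet> R e \<le> Ph e e" unfolding Ph_def by (rule BR_nonneg)
    have "\<beta> * Ph (R e) e \<le> \<beta> * (Ph e e - c * (R e \<bullet> R e))"
      by (rule mult_left_mono[OF upper b(1)])
    moreover have "(1 - \<beta>) * (R e \<bullet> R e) \<le> (1 - \<beta>) * Ph e e"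
      by (rule mult_left_mono[OF ee]) (use b in simp)
    ultimately have "((1 - \<beta>) * 1 + \<beta> * c) * (R e \<bullet> R e) \<le> D e"
      unfolding D_def by (simp add: algebra_simps)
    moreover have "d \<le> (1 - \<beta>) * 1 + \<beta> * c"
    proof -
      have "(1 - \<beta>) * d \<le> (1 - \<beta>) * 1" "\<beta> * d \<le> \<beta> * c"
        by (rule mult_left_mono; use b d in simp)+
      then show ?thesis by (simp add: algebra_simps)
    qed
    ultimately show ?thesis
      by (meson inner_ge_zero mult_right_mono order_trans)
  qed
  text \<open>On an eigenvector with eigenvalue \<open>r\<close> this is
    \<open>V x y - V x' x = (1 - \<beta> r) (x' - y)\<^sup>2\<close> for \<open>V = (1 + \<beta> r) (x\<^sup>2 + y\<^sup>2) - 2 (1 + \<beta>) r x y\<close>.\<close>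
  have W_step: "W (R ((1 + \<beta>) *\<^sub>R a - \<beta> *\<^sub>R b)) a = W a b - D (R ((1 + \<beta>) *\<^sub>R a - \<beta> *\<^sub>R b) - b)" for a b
  proof -
    define a' where "a' = R ((1 + \<beta>) *\<^sub>R a - \<beta> *\<^sub>R b)"
    have W': "W u v = Ph u u + Ph v v + \<beta> * (Ph (R u) u + Ph (R v) v) - 2 * (1 + \<beta>) * Ph (R u) v" for u v
    proof -
      have s: "Ph (R v) u = Ph (R u) v" for u v
        using PhR[of v u] Ph_sym[of v "R u"] by simp
      show ?thesis
        unfolding W_def k_def
        by (simp add: Ph_lin R_simps s[of v u] Ph_sym[of v u] algebra_simps)
    qed
    \<comment> \<open>\<open>R a\<close> enters the cross terms of \<open>W\<close> only with the
      factor \<open>1 + \<beta>\<close>, so it can be eliminated in favour of \<open>a'\<close> and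
      \<open>R b\<close>; the rest is symmetry of \<open>Ph\<close>.\<close>
    have Ra: "(1 + \<beta>) *\<^sub>R R a = a' + \<beta> *\<^sub>R R b"
      by (simp add: a'_def R_simps)
    have 1: "(1 + \<beta>) * Ph (R a) v = Ph a' v + \<beta> * Ph (R b) v" for v
      using arg_cong[OF Ra, of "\<lambda>t. Ph t v"] by (simp only: Ph_lin)
    have s: "Ph (R a') a = Ph (R a) a'" "Ph (R b) a' = Ph (R a') b" "Ph b a' = Ph a' b"
      using PhR[of a' a] Ph_sym[of a' "R a"] PhR[of b a'] Ph_sym[of b "R a'"] Ph_sym[of b a']
      by simp_all
    have "W a' a - W a b + D (a' - b) = 0"
      unfolding W' D_def using 1[of a'] 1[of b] s
      by (simp add: Ph_lin R_simps algebra_simps)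
    then show ?thesis by (simp add: a'_def)
  qed
  define e where "e n = x (Suc (Suc n)) - x n" for n
  define w where "w n = W (x (Suc n)) (x n)" for n
  have wS: "w (Suc n) = w n - D (e n)" for n
    unfolding w_def e_def rec W_step by simp
  have sumD: "(\<Sum>i<n. D (e i)) = w 0 - w n" for n
    by (induction n) (simp_all add: wS)
  have Dnn: "0 \<le> D e" for e
    using D_lower[of e] d(1) by (smt (verit) inner_ge_zero mult_nonneg_nonneg)
  have "summable (\<lambda>n. D (e n))"
  proof (rule bounded_imp_summable)
    show "(\<Sum>k\<le>n. D (e k)) \<le> w 0" for n
      using sumD[of "Suc n"] W_nonneg[of "x (Suc (Suc n))" "x (Suc n)"]
      by (simp add: w_def lessThan_Suc_atMost)
  qed (rule Dnn)
  then have "(\<lambda>n. D (e n) / d) \<longlonglongrightarrow> 0"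
    using summable_LIMSEQ_zero tendsto_divide_zero by blast
  then have "(\<lambda>n. (norm (R (e n)))\<^sup>2) \<longlonglongrightarrow> 0"
    by (rule Lim_null_comparison[rotated])
      (use D_lower d(1) in \<open>auto simp: field_simps power2_norm_eq_inner intro!: always_eventually\<close>)
  then have Re: "(\<lambda>n. R (e n)) \<longlonglongrightarrow> 0"
    using tendsto_real_sqrt[of "\<lambda>n. (norm (R (e n)))\<^sup>2" 0] by (simp add: tendsto_norm_zero_iff)
  \<comment> \<open>\<open>D\<close> controls \<open>R (e n)\<close> but not \<open>e n\<close>, so
    convergence is first shown for \<open>R x\<close>. The recursion then gives it for
    \<open>x\<close>, because its right-hand side depends on \<open>R x\<close> alone.\<close>
  define a where "a n = R (x n)" for n
  have ae: "a (Suc (Suc n)) = a n + R (e n)" for n by (simp add: a_def e_def R_simps)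
  have a_rec: "a (Suc (Suc n)) = R ((1 + \<beta>) *\<^sub>R a (Suc n) - \<beta> *\<^sub>R a n)" for n
    by (simp add: a_def rec R_simps)
  have lim0: "v \<longlonglongrightarrow> 0" if T: "linear T" "\<And>u. T u = 0 \<Longrightarrow> u = 0" "(\<lambda>n. T (v n)) \<longlonglongrightarrow> 0"
    for T :: "'a \<Rightarrow> 'a" and v :: "nat \<Rightarrow> 'a"
  proof -
    have "inj T" using T(1,2) by (simp add: linear_injective_0)
    then obtain g where g: "linear g" "g \<circ> T = id"
      using linear_injective_left_inverse[OF T(1)] by blast
    have "(\<lambda>n. g (T (v n))) \<longlonglongrightarrow> g 0"
      by (intro tendsto_intros bounded_linear.tendsto[OF _ T(3)] linear_conv_bounded_linear[THEN iffD1] g)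
    then show ?thesis using g by (simp add: o_def fun_eq_iff linear_0)
  qed
  have lR: "(\<lambda>n. R (v n)) \<longlonglongrightarrow> 0" if "v \<longlonglongrightarrow> 0" for v :: "nat \<Rightarrow> 'a"
    using bounded_linear.tendsto_zero[OF linear_conv_bounded_linear[THEN iffD1, OF linR] that] .
  have RRe: "(\<lambda>n. R (R (e n))) \<longlonglongrightarrow> 0" by (rule lR[OF Re])
  note Re1 = Re[THEN LIMSEQ_Suc] and RRe1 = RRe[THEN LIMSEQ_Suc]
  \<comment> \<open>With \<open>a (n+2)\<close> replaced by \<open>a n + R (e n)\<close>, two
    consecutive recursions decouple: the sum satisfies \<open>(1 - R) s1 -> 0\<close> and the
    difference \<open>(1 + k R) s2 -> 0\<close>. Both operators are injective, since 1 and
    \<open>- 1 / k\<close> are not eigenvalues of \<open>R\<close>.\<close>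
  define s1 s2 where "s1 n = a (Suc n) + a n" and "s2 n = a (Suc n) - a n" for n
  have rel1: "a n + R (e n) = (1 + \<beta>) *\<^sub>R R (a (Suc n)) - \<beta> *\<^sub>R R (a n)" for n
    using a_rec[of n] unfolding ae by (simp add: R_simps)
  have rel2: "a (Suc n) + R (e (Suc n))
      = (1 + \<beta>) *\<^sub>R (R (a n) + R (R (e n))) - \<beta> *\<^sub>R R (a (Suc n))" for n
    using rel1[of "Suc n"] unfolding ae by (simp add: R_simps)
  have s12: "s1 n - R (s1 n) = (1 + \<beta>) *\<^sub>R R (R (e n)) - R (e n) - R (e (Suc n))"
    "s2 n + k *\<^sub>R R (s2 n) = (1 + \<beta>) *\<^sub>R R (R (e n)) + R (e n) - R (e (Suc n))" for n
  proof -
    have 1: "a n = (1 + \<beta>) *\<^sub>R R (a (Suc n)) - \<beta> *\<^sub>R R (a n) - R (e n)"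
      using rel1[of n] by (simp add: algebra_simps)
    have 2: "a (Suc n) = (1 + \<beta>) *\<^sub>R (R (a n) + R (R (e n))) - \<beta> *\<^sub>R R (a (Suc n)) - R (e (Suc n))"
      using rel2[of n] by (simp add: algebra_simps)
    have R12: "R (s1 n) = R (a (Suc n)) + R (a n)" "R (s2 n) = R (a (Suc n)) - R (a n)"
      by (simp_all add: s1_def s2_def R_simps)
    have 3: "s1 n = ((1 + \<beta>) *\<^sub>R (R (a n) + R (R (e n))) - \<beta> *\<^sub>R R (a (Suc n)) - R (e (Suc n)))
        + ((1 + \<beta>) *\<^sub>R R (a (Suc n)) - \<beta> *\<^sub>R R (a n) - R (e n))"
      unfolding s1_def by (rule arg_cong2[OF 2 1])
    have 4: "s2 n = ((1 + \<beta>) *\<^sub>R (R (a n) + R (R (e n))) - \<beta> *\<^sub>R R (a (Suc n)) - R (e (Suc n)))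
        - ((1 + \<beta>) *\<^sub>R R (a (Suc n)) - \<beta> *\<^sub>R R (a n) - R (e n))"
      unfolding s2_def by (rule arg_cong2[OF 2 1])
    have k: "k = 1 + \<beta> + \<beta>" by (simp add: k_def)
    show "s1 n - R (s1 n) = (1 + \<beta>) *\<^sub>R R (R (e n)) - R (e n) - R (e (Suc n))"
      by (subst R12, subst 3) (simp add: algebra_simps)
    show "s2 n + k *\<^sub>R R (s2 n) = (1 + \<beta>) *\<^sub>R R (R (e n)) + R (e n) - R (e (Suc n))"
      by (subst R12, subst 4, rule euclidean_eqI) (simp add: k inner_simps algebra_simps)
  qed
  have t: "(\<lambda>n. s1 n - R (s1 n)) \<longlonglongrightarrow> 0" "(\<lambda>n. s2 n + k *\<^sub>R R (s2 n)) \<longlonglongrightarrow> 0"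
    using tendsto_diff[OF tendsto_diff[OF tendsto_scaleR[OF tendsto_const RRe] Re] Re1, of "1 + \<beta>"]
      tendsto_diff[OF tendsto_add[OF tendsto_scaleR[OF tendsto_const RRe] Re] Re1, of "1 + \<beta>"]
    by (simp_all add: s12)
  have "s1 \<longlonglongrightarrow> 0"
  proof (rule lim0[where T = "\<lambda>u. u - R u"])
    show "linear (\<lambda>u. u - R u)" by (rule linearI) (simp_all add: R_simps algebra_simps)
    show "(\<lambda>n. s1 n - R (s1 n)) \<longlonglongrightarrow> 0" by (rule t)
    show "u = 0" if "u - R u = 0" for u using that fixed_point_zero by simp
  qed
  moreover have "s2 \<longlonglongrightarrow> 0"
  proof (rule lim0[where T = "\<lambda>u. u + k *\<^sub>R R u"])
    show "linear (\<lambda>u. u + k *\<^sub>R R u)" by (rule linearI) (simp_all add: R_simps algebra_simps)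
    show "(\<lambda>n. s2 n + k *\<^sub>R R (s2 n)) \<longlonglongrightarrow> 0" by (rule t)
    show "u = 0" if "u + k *\<^sub>R R u = 0" for u
    proof (rule ccontr)
      assume "u \<noteq> 0"
      have "k *\<^sub>R R u = - u" using that by (simp add: eq_neg_iff_add_eq_0 add.commute)
      then have "(1 / k) *\<^sub>R k *\<^sub>R R u = (- 1 / k) *\<^sub>R u" by simp
      then have "R u = (- 1 / k) *\<^sub>R u" using k by simp
      then show False using ev[OF \<open>u \<noteq> 0\<close>] by (force simp: k_def)
    qed
  qed
  ultimately have "(\<lambda>n. (1/2) *\<^sub>R (s1 n - s2 n)) \<longlonglongrightarrow> (1/2) *\<^sub>R (0 - 0)"
    by (intro tendsto_intros)
  then have a0: "a \<longlonglongrightarrow> 0" by (simp add: s1_def s2_def flip: scaleR_2)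
  have "x (Suc (Suc n)) = (1 + \<beta>) *\<^sub>R a (Suc n) - \<beta> *\<^sub>R a n" for n
    by (simp add: rec a_def R_simps)
  then have "(\<lambda>n. x (Suc (Suc n))) \<longlonglongrightarrow> (1 + \<beta>) *\<^sub>R 0 - \<beta> *\<^sub>R 0"
    using tendsto_diff[OF tendsto_scaleR[OF tendsto_const a0[THEN LIMSEQ_Suc], of "1 + \<beta>"]
        tendsto_scaleR[OF tendsto_const a0, of \<beta>]] by simp
  then show ?thesis using filterlim_sequentially_Suc[of x] filterlim_sequentially_Suc[of "\<lambda>n. x (Suc n)"] by simp
qed

lemma two_step_operator_linear:
  assumes T: "T = (\<lambda>(h1, h2). ((1 + \<beta>) *\<^sub>R R h1 - \<beta> *\<^sub>R R h2, h1))"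
  shows "linear T"
proof (rule linearI)
  show "T (p + q) = T p + T q" for p q
    by (simp add: T split_beta R_simps scaleR_add_right)
  show "T (r *\<^sub>R p) = r *\<^sub>R T p" for r p
    by (simp add: T split_beta R_simps scaleR_diff_right mult.commute[of r])
qed

lemma two_step_operator_power_tendsto_0:
  fixes \<beta> :: real and z :: "'a \<times> 'a"
  assumes "0 \<le> \<beta>" "\<beta> \<le> 1"
    "\<And>l v. v \<noteq> 0 \<Longrightarrow> R v = l *\<^sub>R v \<Longrightarrow> - 1 / (1 + 2 * \<beta>) < l"
    and T: "T = (\<lambda>(h1, h2). ((1 + \<beta>) *\<^sub>R R h1 - \<beta> *\<^sub>R R h2, h1))"
  shows "(\<lambda>n. (T ^^ n) z) \<longlonglongrightarrow> 0"
proof -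
  \<comment> \<open>The older iterate is the second component, so \<open>(T ^^ n) z\<close> is the
    pair of \<open>x (n+1)\<close> and \<open>x n\<close>, and \<open>z\<close> supplies two
    arbitrary starting values.\<close>
  define x where "x n = snd ((T ^^ n) z)" for n
  have Suc: "x (Suc n) = fst ((T ^^ n) z)" for n
    by (simp add: x_def T split_beta)
  have "x (Suc (Suc n)) = R ((1 + \<beta>) *\<^sub>R x (Suc n) - \<beta> *\<^sub>R x n)" for n
    unfolding Suc by (simp add: x_def T split_beta R_simps)
  then have "x \<longlonglongrightarrow> 0" using two_step_converges[of \<beta> x] assms(1-3) by blast
  moreover have "(\<lambda>n. x (Suc n)) \<longlonglongrightarrow> 0" by (rule LIMSEQ_Suc) fact
  ultimately have "(\<lambda>n. (x (Suc n), x n)) \<longlonglongrightarrow> (0, 0)" by (intro tendsto_Pair)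
  moreover have "(x (Suc n), x n) = (T ^^ n) z" for n
    unfolding Suc by (simp add: x_def)
  ultimately show ?thesis by (simp add: zero_prod_def)
qed

end

section \<open>Linear iterations with vanishing perturbations\<close>

lemma perturbed_contraction_tendsto_0:
  fixes p s :: "nat \<Rightarrow> real"
  assumes q: "0 \<le> q" "q < 1" and p: "\<And>k. 0 \<le> p k" and s: "s \<longlonglongrightarrow> 0"
    and step: "\<forall>\<^sub>F k in sequentially. p (Suc k) \<le> q * p k + s k"
  shows "p \<longlonglongrightarrow> 0"
proof (rule LIMSEQ_I)
  fix e :: real assume e: "0 < e"
  \<comment> \<open>Once \<open>s k < (1 - q) d\<close>, the excess \<open>p k - d\<close> is
    bounded by a geometric sequence. The absolute value of the starting excess covers a negative
    one.\<close>
  define d where "d = e / 2"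
  have "0 < (1 - q) * d" using e q by (simp add: d_def)
  then have "\<forall>\<^sub>F k in sequentially. s k < (1 - q) * d" by (rule order_tendstoD[OF s])
  with step have "\<forall>\<^sub>F k in sequentially. p (Suc k) - d \<le> q * (p k - d)"
    by eventually_elim (simp add: algebra_simps)
  then obtain K where K: "\<And>k. k \<ge> K \<Longrightarrow> p (Suc k) - d \<le> q * (p k - d)"
    by (auto simp: eventually_sequentially)
  have *: "p (K + n) - d \<le> q ^ n * \<bar>p K - d\<bar>" for n
  proof (induction n)
    case (Suc n)
    have "p (K + Suc n) - d \<le> q * (p (K + n) - d)" using K[of "K + n"] by simp
    also have "\<dots> \<le> q * (q ^ n * \<bar>p K - d\<bar>)" by (rule mult_left_mono[OF Suc q(1)])
    finally show ?case by simp
  qed simp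
  have "(\<lambda>n. q ^ n * \<bar>p K - d\<bar>) \<longlonglongrightarrow> 0"
    using LIMSEQ_realpow_zero[OF q] by (rule tendsto_mult_left_zero)
  then have "\<forall>\<^sub>F n in sequentially. q ^ n * \<bar>p K - d\<bar> < d"
    by (rule order_tendstoD) (use e in \<open>simp add: d_def\<close>)
  then obtain N where N: "\<And>n. n \<ge> N \<Longrightarrow> q ^ n * \<bar>p K - d\<bar> < d"
    by (auto simp: eventually_sequentially)
  show "\<exists>n0. \<forall>n\<ge>n0. norm (p n - 0) < e"
  proof (intro exI[of _ "K + N"] allI impI)
    fix n assume "K + N \<le> n"
    then obtain m where m: "n = K + m" "m \<ge> N" by (metis add_le_imp_le_left le_add1 le_iff_add le_trans)
    have "p n - d < d" using *[of m] N[OF m(2)] by (simp add: m(1))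
    then show "norm (p n - 0) < e" using p[of n] by (simp add: d_def)
  qed
qed

lemma linear_funpow: "linear (T :: 'a::real_vector \<Rightarrow> 'a) \<Longrightarrow> linear (T ^^ n)"
proof (induction n)
  case 0
  show ?case by (rule linearI) simp_all
next
  case (Suc n)
  then show ?case using linear_compose[of "T ^^ n" T] by (simp add: o_def)
qed

text \<open>Convergence of the powers on a basis makes some power \<open>T ^^ N\<close> halve every
  norm. \<open>T\<close> itself need not contract in the given norm, so the norms of the first
  \<open>N\<close> images are added up.\<close>

lemma perturbed_linear_iteration_tendsto_0:
  fixes T :: "'z::euclidean_space \<Rightarrow> 'z" and e :: "nat \<Rightarrow> 'z"
  assumes lin: "linear T" and pow: "\<And>z. (\<lambda>n. (T ^^ n) z) \<longlonglongrightarrow> 0"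
    and step: "\<forall>\<^sub>F k in sequentially. norm (e (Suc k) - T (e k)) \<le> \<eta> k * norm (e k) + r k"
    and lim: "\<eta> \<longlonglongrightarrow> 0" "r \<longlonglongrightarrow> 0"
  shows "e \<longlonglongrightarrow> 0"
proof -
  have bl: "bounded_linear (T ^^ n)" for n
    using linear_funpow[OF lin] by (simp add: linear_conv_bounded_linear)
  have "(\<lambda>n. \<Sum>i\<in>Basis. norm ((T ^^ n) i)) \<longlonglongrightarrow> (\<Sum>i\<in>(Basis::'z set). 0)"
    by (intro tendsto_sum tendsto_norm_zero pow)
  then have "\<forall>\<^sub>F n in sequentially. (\<Sum>i\<in>Basis. norm ((T ^^ n) i)) < 1/2"
    by (rule order_tendstoD) simp
  then obtain N where "(\<Sum>i\<in>Basis. norm ((T ^^ N) i)) < 1/2"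
    by (auto simp: eventually_sequentially)
  then have "onorm (T ^^ N) \<le> 1/2" using onorm_componentwise[OF bl, of N] by simp
  then have half: "norm ((T ^^ N) z) \<le> 1/2 * norm z" for z
    using onorm[OF bl, of N z] by (meson mult_right_mono norm_ge_zero order_trans)
  have N: "0 < N"
  proof (rule ccontr)
    assume "\<not> 0 < N"
    then have "norm z \<le> 1/2 * norm z" for z :: 'z using half[of z] by simp
    from this[of "SOME b. b \<in> Basis"] show False by (simp add: norm_Basis some_in_eq)
  qed
  text \<open>The iteration contracts in this adapted norm.\<close>
  define p where "p z = (\<Sum>i<N. norm ((T ^^ i) z))" for z
  define C where "C = (\<Sum>i<N. onorm (T ^^ i))"
  have p_ge: "norm z \<le> p z" for z
    using member_le_sum[of 0 "{..<N}" "\<lambda>i. norm ((T ^^ i) z)"] N by (simp add: p_def)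
  have pC: "p z \<le> C * norm z" for z
    unfolding p_def C_def sum_distrib_right by (rule sum_mono) (rule onorm[OF bl])
  have C1: "1 \<le> C"
    using p_ge[of "SOME b. b \<in> Basis"] pC[of "SOME b. b \<in> Basis"]
    by (simp add: norm_Basis some_in_eq)
  have p_tri: "p (x + y) \<le> p x + p y" for x y
  proof -
    have "(\<Sum>i<N. norm ((T ^^ i) (x + y))) \<le> (\<Sum>i<N. norm ((T ^^ i) x) + norm ((T ^^ i) y))"
      by (rule sum_mono) (simp add: linear_add[OF linear_funpow[OF lin]] norm_triangle_ineq)
    then show ?thesis
      unfolding p_def by (simp add: sum.distrib)
  qed
  \<comment> \<open>Applying \<open>T\<close> shifts the sum: \<open>norm z\<close> leaves and at
    most half of it enters. The net loss \<open>norm z / 2\<close> is at least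
    \<open>p z / (2 C)\<close>.\<close>
  have pT: "p (T z) \<le> (1 - 1 / (2 * C)) * p z" for z
  proof -
    have "p (T z) = (\<Sum>i<N. norm ((T ^^ Suc i) z))" by (simp add: p_def funpow_swap1)
    also have "\<dots> = p z - norm z + norm ((T ^^ N) z)"
      using sum.lessThan_Suc_shift[of "\<lambda>i. norm ((T ^^ i) z)" N] by (simp add: p_def)
    also have "\<dots> \<le> p z - 1/2 * norm z" using half[of z] by simp
    also have "\<dots> \<le> p z - 1 / (2 * C) * p z" using pC[of z] C1 by (simp add: field_simps)
    finally show ?thesis by (simp add: algebra_simps)
  qed
  define s where "s k = C * r k" for k
  \<comment> \<open>Half of the gap \<open>1 / (2 C)\<close> is given up to absorb the relative
    perturbation, which eventually satisfies \<open>C * \<eta> k < 1 / (4 C)\<close>.\<close>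
  define q where "q = 1 - 1 / (4 * C)"
  have "(\<lambda>k. C * \<eta> k) \<longlonglongrightarrow> C * 0" by (intro tendsto_intros lim)
  then have "\<forall>\<^sub>F k in sequentially. C * \<eta> k < 1 / (4 * C)"
    by (rule order_tendstoD) (use C1 in simp)
  with step have "\<forall>\<^sub>F k in sequentially. p (e (Suc k)) \<le> q * p (e k) + s k"
  proof eventually_elim
    case (elim k)
    have "p (e (Suc k)) \<le> p (T (e k)) + p (e (Suc k) - T (e k))"
      using p_tri[of "T (e k)" "e (Suc k) - T (e k)"] by simp
    also have "\<dots> \<le> p (T (e k)) + C * norm (e (Suc k) - T (e k))"
      using pC by simp
    also have "\<dots> \<le> p (T (e k)) + C * (\<eta> k * norm (e k) + r k)"
      using elim(1) C1 by simp
    also have "\<dots> = p (T (e k)) + (C * \<eta> k) * norm (e k) + s k"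
      by (simp add: s_def algebra_simps)
    also have "\<dots> \<le> p (T (e k)) + 1 / (4 * C) * norm (e k) + s k"
      using mult_right_mono[OF less_imp_le[OF elim(2)] norm_ge_zero[of "e k"]] by simp
    also have "\<dots> \<le> (1 - 1 / (2 * C)) * p (e k) + 1 / (4 * C) * p (e k) + s k"
      using pT[of "e k"] p_ge[of "e k"] C1
      by (intro add_mono mult_left_mono) simp_all
    also have "\<dots> = q * p (e k) + s k"
      by (simp add: q_def algebra_simps)
    finally show ?case .
  qed
  moreover have "s \<longlonglongrightarrow> 0"
    unfolding s_def using tendsto_mult[OF tendsto_const lim(2), of C] by simp
  moreover have "0 \<le> q" "q < 1" using C1 by (simp_all add: q_def)
  moreover have "0 \<le> p (e k)" for k by (rule order_trans[OF norm_ge_zero p_ge])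
  ultimately have "(\<lambda>k. p (e k)) \<longlonglongrightarrow> 0"
    using perturbed_contraction_tendsto_0[of q "\<lambda>k. p (e k)" s] by blast
  then show "e \<longlonglongrightarrow> 0"
    by (rule Lim_null_comparison[rotated]) (simp add: p_ge)
qed

section \<open>Derivatives of gradient fields\<close>

lemma has_derivative_directional:
  assumes "(f has_derivative A) (at x)"
  shows "((\<lambda>t::real. (1 / t) *\<^sub>R (f (x + t *\<^sub>R s) - f x)) \<longlongrightarrow> A s) (at 0)"
proof -
  have "((\<lambda>t::real. x + t *\<^sub>R s) has_derivative (\<lambda>t. t *\<^sub>R s)) (at 0)"
    by (auto intro!: derivative_eq_intros)
  then have "((\<lambda>t::real. f (x + t *\<^sub>R s)) has_derivative (\<lambda>t. A (t *\<^sub>R s))) (at 0)"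
    using has_derivative_compose[of "\<lambda>t::real. x + t *\<^sub>R s" _ 0 UNIV f A] assms by simp
  then have "((\<lambda>t::real. norm (f (x + t *\<^sub>R s) - f x - A (t *\<^sub>R s)) / norm t) \<longlongrightarrow> 0) (at 0)"
    by (simp add: has_derivative_at)
  moreover have "\<forall>\<^sub>F t in at 0. norm (f (x + t *\<^sub>R s) - f x - A (t *\<^sub>R s)) / norm t
      = norm ((1 / t) *\<^sub>R (f (x + t *\<^sub>R s) - f x) - A s)" for t :: real
  proof (rule eventually_at_topological[THEN iffD2], intro exI[of _ UNIV] conjI ballI impI)
    fix t :: real assume "t \<noteq> 0"
    have "norm ((1 / t) *\<^sub>R (f (x + t *\<^sub>R s) - f x) - A s)
      = norm ((1 / t) *\<^sub>R (f (x + t *\<^sub>R s) - f x - A (t *\<^sub>R s)))"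
      using \<open>t \<noteq> 0\<close> linear_scale[OF has_derivative_linear[OF assms]]
      by (simp add: scaleR_diff_right)
    then show "norm (f (x + t *\<^sub>R s) - f x - A (t *\<^sub>R s)) / norm t
      = norm ((1 / t) *\<^sub>R (f (x + t *\<^sub>R s) - f x) - A s)" by simp
  qed auto
  ultimately have "((\<lambda>t::real. norm ((1 / t) *\<^sub>R (f (x + t *\<^sub>R s) - f x) - A s)) \<longlongrightarrow> 0) (at 0)"
    by (rule Lim_transform_eventually)
  then show ?thesis by (simp add: tendsto_norm_zero_iff LIM_zero_iff)
qed

text \<open>The mean value theorem is applied in direction \<open>v\<close> to the increment in
  direction \<open>u\<close>. It uses the gradient near \<open>x\<close> but differentiates it at
  \<open>x\<close> alone, which is all that is known of the gradient field built from the proximal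
  map.\<close>

lemma second_difference_estimate:
  fixes G :: "'a::euclidean_space \<Rightarrow> real"
  assumes G: "\<And>y. GDERIV G y :> F y" and F: "(F has_derivative A) (at x)" and e: "0 < e"
  shows "\<forall>\<^sub>F t in at_right 0. \<bar>G (x + t *\<^sub>R u + t *\<^sub>R v) - G (x + t *\<^sub>R u) - G (x + t *\<^sub>R v) + G x
      - t\<^sup>2 * (A u \<bullet> v)\<bar> \<le> e * t\<^sup>2"
proof -
  define N where "N = norm u + norm v + 1"
  have N: "0 < N" "norm u \<le> N" "norm v \<le> N" by (auto simp: N_def add_nonneg_pos)
  \<comment> \<open>All displacements have norm at most \<open>t * N\<close>, so two remainders,
    paired with \<open>v\<close> and multiplied by \<open>t\<close>, cost
    \<open>2 r N^2 t^2 = e t^2\<close>.\<close>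
  define r where "r = e / (2 * N * N)"
  have r: "0 < r" using e N by (simp add: r_def)
  obtain d where d: "0 < d" "\<And>y. norm (y - x) < d \<Longrightarrow> norm (F y - F x - A (y - x)) \<le> r * norm (y - x)"
    using F r unfolding has_derivative_at_alt by blast
  note A = linear_add[OF has_derivative_linear[OF F]] linear_scale[OF has_derivative_linear[OF F]]
  have "\<bar>G (x + t *\<^sub>R u + t *\<^sub>R v) - G (x + t *\<^sub>R u) - G (x + t *\<^sub>R v) + G x
      - t\<^sup>2 * (A u \<bullet> v)\<bar> \<le> e * t\<^sup>2" if t: "0 < t" "t < d / N" for t
  proof -
    have tN: "t * N < d" using t N by (simp add: field_simps)
    define \<phi> where "\<phi> s = G (x + t *\<^sub>R u + s *\<^sub>R v) - G (x + s *\<^sub>R v)" for s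
    have D: "((\<lambda>s. G (y + s *\<^sub>R v)) has_real_derivative F (y + s *\<^sub>R v) \<bullet> v) (at s)" for y s
    proof -
      have "((\<lambda>s. y + s *\<^sub>R v) has_derivative (\<lambda>s. s *\<^sub>R v)) (at s)"
        by (auto intro!: derivative_eq_intros)
      moreover have "(G has_derivative (\<lambda>h. h \<bullet> F (y + s *\<^sub>R v))) (at (y + s *\<^sub>R v))"
        using G by (simp add: gderiv_def)
      ultimately have "((\<lambda>s. G (y + s *\<^sub>R v)) has_derivative (\<lambda>h. (h *\<^sub>R v) \<bullet> F (y + s *\<^sub>R v))) (at s)"
        by (rule has_derivative_compose)
      then show ?thesis
        by (rule has_derivative_imp_has_field_derivative) (simp add: inner_commute)
    qed
    have "(\<phi> has_real_derivative (F (x + t *\<^sub>R u + s *\<^sub>R v) - F (x + s *\<^sub>R v)) \<bullet> v) (at s)" for s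
      unfolding \<phi>_def inner_diff_left by (intro DERIV_diff D)
    then obtain z where z: "0 < z" "z < t"
      "\<phi> t - \<phi> 0 = (t - 0) * ((F (x + t *\<^sub>R u + z *\<^sub>R v) - F (x + z *\<^sub>R v)) \<bullet> v)"
      using MVT2[OF t(1), of \<phi> "\<lambda>s. (F (x + t *\<^sub>R u + s *\<^sub>R v) - F (x + s *\<^sub>R v)) \<bullet> v"] by blast
    define a where "a = F (x + t *\<^sub>R u + z *\<^sub>R v) - F x - A (t *\<^sub>R u + z *\<^sub>R v)"
    define b where "b = F (x + z *\<^sub>R v) - F x - A (z *\<^sub>R v)"
    have n1: "norm (t *\<^sub>R u + z *\<^sub>R v) \<le> t * N"
    proof -
      have "norm (t *\<^sub>R u + z *\<^sub>R v) \<le> t * norm u + z * norm v"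
        using norm_triangle_ineq[of "t *\<^sub>R u" "z *\<^sub>R v"] t z by simp
      also have "\<dots> \<le> t * norm u + t * norm v" using z by (simp add: mult_right_mono)
      also have "\<dots> \<le> t * N" using t by (simp add: N_def algebra_simps)
      finally show ?thesis .
    qed
    have n2: "norm (z *\<^sub>R v) \<le> t * N"
      using z t N by (simp add: mult_mono)
    have "norm a \<le> r * norm (t *\<^sub>R u + z *\<^sub>R v)"
      using d(2)[of "x + t *\<^sub>R u + z *\<^sub>R v"] n1 tN by (simp add: a_def algebra_simps)
    also have "\<dots> \<le> r * (t * N)" using n1 r by simp
    finally have a: "norm a \<le> r * (t * N)" .
    have "norm b \<le> r * norm (z *\<^sub>R v)"
      using d(2)[of "x + z *\<^sub>R v"] n2 tN by (simp add: b_def)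
    also have "\<dots> \<le> r * (t * N)" using n2 r by simp
    finally have b: "norm b \<le> r * (t * N)" .
    \<comment> \<open>The unknown intermediate point \<open>z\<close> cancels from the linear
      part.\<close>
    have Fab: "F (x + t *\<^sub>R u + z *\<^sub>R v) - F (x + z *\<^sub>R v) = t *\<^sub>R A u + (a - b)"
      by (simp add: a_def b_def A)
    have "G (x + t *\<^sub>R u + t *\<^sub>R v) - G (x + t *\<^sub>R u) - G (x + t *\<^sub>R v) + G x - t\<^sup>2 * (A u \<bullet> v)
      = t * ((a - b) \<bullet> v)"
      using z(3)[unfolded Fab] by (simp add: \<phi>_def inner_add_left power2_eq_square algebra_simps)
    also have "\<bar>\<dots>\<bar> \<le> t * (norm (a - b) * norm v)"
      using t Cauchy_Schwarz_ineq2[of "a - b" v] by (simp add: abs_mult)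
    also have "\<dots> \<le> t * ((2 * (r * (t * N))) * N)"
    proof -
      have "norm (a - b) \<le> 2 * (r * (t * N))"
        using a b norm_triangle_ineq4[of a b] by linarith
      then show ?thesis using t N r by (intro mult_left_mono mult_mono) simp_all
    qed
    also have "\<dots> = e * t\<^sup>2" using N by (simp add: r_def power2_eq_square)
    finally show ?thesis .
  qed
  then show ?thesis
    using d(1) N(1) by (intro eventually_at_right_field[THEN iffD2] exI[of _ "d / N"]) auto
qed

text \<open>The second difference is symmetric in \<open>u\<close> and \<open>v\<close>, so both
  bilinear values approximate it; dividing by \<open>t^2\<close> compares them.\<close>

lemma gradient_derivative_symmetric:
  fixes G :: "'a::euclidean_space \<Rightarrow> real"
  assumes G: "\<And>y. GDERIV G y :> F y" and F: "(F has_derivative A) (at x)"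
  shows "A u \<bullet> v = A v \<bullet> u"
proof -
  have "\<bar>A u \<bullet> v - A v \<bullet> u\<bar> \<le> e" if "0 < e" for e
  proof -
    have "0 < e / 2" using that by simp
    have swap: "x + t *\<^sub>R v + t *\<^sub>R u = x + t *\<^sub>R u + t *\<^sub>R v" for t :: real by simp
    from second_difference_estimate[OF G F \<open>0 < e / 2\<close>, of u v]
      second_difference_estimate[OF G F \<open>0 < e / 2\<close>, of v u]
    have "\<forall>\<^sub>F t in at_right (0::real). \<bar>A u \<bullet> v - A v \<bullet> u\<bar> \<le> e"
      using eventually_at_right_less[of 0]
    proof eventually_elim
      case (elim t)
      have "t\<^sup>2 * \<bar>A u \<bullet> v - A v \<bullet> u\<bar> = \<bar>t\<^sup>2 * (A u \<bullet> v) - t\<^sup>2 * (A v \<bullet> u)\<bar>"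
        by (simp add: abs_mult flip: right_diff_distrib)
      also have "\<dots> \<le> t\<^sup>2 * e"
        using elim(1,2) unfolding swap[of t] abs_le_iff by (simp add: field_simps)
      finally show ?case using elim(3) by simp
    qed
    then show ?thesis by (rule eventually_happens'[OF trivial_limit_at_right_real, THEN exE])
  qed
  then have "\<bar>A u \<bullet> v - A v \<bullet> u\<bar> \<le> 0" by (rule field_le_epsilon) simp
  then show ?thesis by simp
qed

section \<open>The proximal map of a convex extended-valued function\<close>

text \<open>Compare \<open>p\<close> with \<open>p + t (y - p)\<close>, bound \<open>h\<close> there
  by convexity, divide by \<open>t\<close> and let \<open>t\<close> tend to 0. Real heights over the
  epigraph keep infinite values out of the arithmetic.\<close>

lemma convex_min_sum_imp_subgradient:
  fixes h :: "'a::real_inner \<Rightarrow> ereal"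
  assumes cvx: "convex (ereal_epigraph h)" and D: "GDERIV \<phi> p :> d"
    and hp: "h p \<le> ereal a" and min: "\<And>y r. h y \<le> ereal r \<Longrightarrow> a + \<phi> p \<le> r + \<phi> y"
    and hy: "h y \<le> ereal b"
  shows "a - d \<bullet> (y - p) \<le> b"
proof -
  have "(\<phi> has_derivative (\<lambda>h. h \<bullet> d)) (at p)" using D by (simp add: gderiv_def)
  note has_derivative_directional[OF this, of "y - p"]
  then have lim: "((\<lambda>t. (1 / t) *\<^sub>R (\<phi> (p + t *\<^sub>R (y - p)) - \<phi> p)) \<longlongrightarrow> (y - p) \<bullet> d) (at_right 0)"
    by (rule tendsto_mono[OF at_le[OF subset_UNIV]])
  have "\<forall>\<^sub>F t in at_right 0. a - b \<le> (1 / t) *\<^sub>R (\<phi> (p + t *\<^sub>R (y - p)) - \<phi> p)"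
  proof (intro eventually_at_right_field[THEN iffD2] exI[of _ 1] conjI allI impI)
    fix t :: real assume t: "0 < t" "t < 1"
    have "(1 - t) *\<^sub>R (p, a) + t *\<^sub>R (y, b) \<in> ereal_epigraph h"
      using cvx hp hy t by (intro convexD) (auto simp: ereal_epigraph_def)
    then have "h (p + t *\<^sub>R (y - p)) \<le> ereal (a + t * (b - a))"
      by (simp add: ereal_epigraph_def algebra_simps)
    from min[OF this] have "t * (a - b) \<le> \<phi> (p + t *\<^sub>R (y - p)) - \<phi> p"
      by (simp add: algebra_simps)
    then show "a - b \<le> (1 / t) *\<^sub>R (\<phi> (p + t *\<^sub>R (y - p)) - \<phi> p)"
      using t by (simp add: field_simps)
  qed simp
  with lim have "a - b \<le> (y - p) \<bullet> d"
    by (rule tendsto_lowerbound) simp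
  then show ?thesis by (simp add: inner_commute)
qed

text \<open>Expanding the square leaves a strict excess of half the squared distance to
  \<open>p\<close>. Uniqueness of the minimizer is what identifies the choice made by
  \<open>ARG_MIN\<close>.\<close>

lemma prox_eqI:
  fixes h :: "'a::euclidean_space \<Rightarrow> ereal"
  assumes \<alpha>: "0 < \<alpha>" and ninf: "\<And>y. h y \<noteq> -\<infinity>" and hp: "h p = ereal a"
    and sub: "\<And>y r. h y \<le> ereal r \<Longrightarrow> \<alpha> * a + (w - p) \<bullet> (y - p) \<le> \<alpha> * r"
  shows "prox \<alpha> h w = p"
proof -
  let ?F = "\<lambda>x. ereal \<alpha> * h x + ereal (1 / 2 * (norm (x - w))\<^sup>2)"
  have lt: "?F p < ?F y" if "y \<noteq> p" for y
  proof (cases "h y")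
    case (real r)
    have "\<alpha> * a + (w - p) \<bullet> (y - p) \<le> \<alpha> * r" using sub[of y r] real by simp
    moreover have "(norm (y - w))\<^sup>2 = (norm (p - w))\<^sup>2 - 2 * ((w - p) \<bullet> (y - p)) + (norm (y - p))\<^sup>2"
      by (simp add: power2_norm_eq_inner inner_diff_left inner_diff_right inner_commute)
    moreover have "0 < (norm (y - p))\<^sup>2" using that by simp
    ultimately have "\<alpha> * a + 1 / 2 * (norm (p - w))\<^sup>2 < \<alpha> * r + 1 / 2 * (norm (y - w))\<^sup>2"
      by linarith
    then show ?thesis using real hp by simp
  next
    case PInf
    then show ?thesis using \<alpha> hp by simp
  qed (use ninf in simp)
  have "is_arg_min ?F (\<lambda>x. True) x \<longleftrightarrow> x = p" for x
    unfolding is_arg_min_def using lt by (metis less_asym less_irrefl)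
  then have "is_arg_min ?F (\<lambda>x. True) = (\<lambda>x. x = p)" by (intro ext)
  then show ?thesis unfolding prox_def arg_min_def by (simp only: some_eq_trivial)
qed

lemma prox_minimizer_exists:
  fixes h :: "'a::euclidean_space \<Rightarrow> ereal"
  assumes cvx: "convex (ereal_epigraph h)" and cl: "closed (ereal_epigraph h)"
    and \<alpha>: "0 < \<alpha>" and ninf: "\<And>y. h y \<noteq> -\<infinity>" and x0: "h x0 = ereal a0"
    and minor: "\<And>y r. h y \<le> ereal r \<Longrightarrow> a0 + v \<bullet> (y - x0) \<le> r"
  obtains p a where "h p = ereal a"
    "\<And>y r. h y \<le> ereal r \<Longrightarrow> \<alpha> * a + (w - p) \<bullet> (y - p) \<le> \<alpha> * r"
proof -
  \<comment> \<open>Minimizing over the epigraph replaces a semicontinuous objective by a continuous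
    one on a closed set; the affine minorant makes its sublevel sets bounded.\<close>
  define J where "J z = \<alpha> * snd z + 1 / 2 * (norm (fst z - w))\<^sup>2" for z :: "'a \<times> real"
  define c0 where "c0 = J (x0, a0)"
  define K where "K = ereal_epigraph h \<inter> {z. J z \<le> c0}"
  have J_cont: "continuous_on S J" for S
    unfolding J_def by (intro continuous_intros)
  have "closed {z. J z \<le> c0}"
    by (intro closed_Collect_le J_cont continuous_intros)
  then have K_closed: "closed K" unfolding K_def using cl by (rule closed_Int[rotated])
  have x0K: "(x0, a0) \<in> K" using x0 by (simp add: K_def c0_def ereal_epigraph_def)
  \<comment> \<open>Obtained by inserting the minorant into \<open>J \<le> c0\<close> and completing
    the square around \<open>w - \<alpha> v\<close>.\<close>
  define E where "E = 2 * (c0 - \<alpha> * a0 + \<alpha> * (v \<bullet> (x0 - w))) + (norm (\<alpha> *\<^sub>R v))\<^sup>2"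
  have Kb: "norm (fst z) \<le> norm (w - \<alpha> *\<^sub>R v) + sqrt E
      \<and> \<bar>snd z\<bar> \<le> \<bar>c0 / \<alpha>\<bar> + \<bar>a0\<bar> + norm v * (norm (w - \<alpha> *\<^sub>R v) + sqrt E + norm x0)" if "z \<in> K" for z
  proof -
    obtain y r where z: "z = (y, r)" by fastforce
    have le: "h y \<le> ereal r" "\<alpha> * r + 1 / 2 * (norm (y - w))\<^sup>2 \<le> c0"
      using that by (auto simp: z K_def ereal_epigraph_def J_def)
    have m: "a0 + v \<bullet> (y - x0) \<le> r" by (rule minor[OF le(1)])
    have "\<alpha> * (a0 + v \<bullet> (y - x0)) + 1 / 2 * (norm (y - w))\<^sup>2 \<le> c0"
      using mult_left_mono[OF m, of \<alpha>] \<alpha> le(2) by linarith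
    moreover have "(norm (y - (w - \<alpha> *\<^sub>R v)))\<^sup>2
        = (norm (y - w))\<^sup>2 + 2 * (\<alpha> * (v \<bullet> (y - w))) + (norm (\<alpha> *\<^sub>R v))\<^sup>2"
      unfolding power2_norm_eq_inner
      by (simp add: inner_diff_left inner_diff_right inner_add_left inner_add_right
          inner_commute algebra_simps)
    ultimately have "(norm (y - (w - \<alpha> *\<^sub>R v)))\<^sup>2 \<le> E"
      by (simp add: E_def inner_diff_right algebra_simps)
    then have "norm (y - (w - \<alpha> *\<^sub>R v)) \<le> sqrt E" by (rule real_le_rsqrt)
    then have ny: "norm y \<le> norm (w - \<alpha> *\<^sub>R v) + sqrt E"
      using norm_triangle_sub[of y "w - \<alpha> *\<^sub>R v"] by linarith
    have "\<alpha> * r \<le> c0" using le(2) zero_le_power2[of "norm (y - w)"] by linarith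
    then have "r \<le> c0 / \<alpha>" using \<alpha> by (simp add: field_simps)
    moreover have "\<bar>v \<bullet> (y - x0)\<bar> \<le> norm v * (norm (w - \<alpha> *\<^sub>R v) + sqrt E + norm x0)"
      using Cauchy_Schwarz_ineq2[of v "y - x0"] norm_triangle_ineq4[of y x0] ny
      by (smt (verit) mult_left_mono norm_ge_zero)
    ultimately have "\<bar>r\<bar> \<le> \<bar>c0 / \<alpha>\<bar> + \<bar>a0\<bar> + norm v * (norm (w - \<alpha> *\<^sub>R v) + sqrt E + norm x0)"
      using m by linarith
    then show ?thesis using ny by (simp only: z fst_conv snd_conv)
  qed
  define B1 where "B1 = norm (w - \<alpha> *\<^sub>R v) + sqrt E"
  define B2 where "B2 = \<bar>c0 / \<alpha>\<bar> + \<bar>a0\<bar> + norm v * (norm (w - \<alpha> *\<^sub>R v) + sqrt E + norm x0)"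
  have "K \<subseteq> cball 0 B1 \<times> cball 0 B2"
    using Kb by (force simp: B1_def B2_def)
  then have "bounded K" by (rule bounded_subset[rotated]) (intro bounded_Times bounded_cball)
  with K_closed have "compact K" by (simp add: compact_eq_bounded_closed)
  moreover have "K \<noteq> {}" using x0K by blast
  ultimately obtain z where z: "z \<in> K" "\<forall>y\<in>K. J z \<le> J y"
    using continuous_attains_inf[OF _ _ J_cont] by metis
  obtain p a where pa: "z = (p, a)" by fastforce
  have hpa: "h p \<le> ereal a" using z(1) by (simp add: pa K_def ereal_epigraph_def)
  have min: "J (p, a) \<le> J (y, r)" if "h y \<le> ereal r" for y r
  proof (cases "J (y, r) \<le> c0")
    case True
    then show ?thesis using z(2) that by (simp add: pa K_def ereal_epigraph_def)
  next
    case False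
    then show ?thesis using z(1) by (simp add: pa K_def)
  qed
  have "h p = ereal a"
  proof (cases "h p")
    case (real b)
    then have "J (p, a) \<le> J (p, b)" by (intro min) simp
    then show ?thesis using hpa \<alpha> real by (simp add: J_def)
  qed (use ninf hpa in auto)
  moreover have "\<alpha> * a + (w - p) \<bullet> (y - p) \<le> \<alpha> * r" if "h y \<le> ereal r" for y r
  proof -
    have "GDERIV (\<lambda>x. 1 / (2 * \<alpha>) * (norm (x - w))\<^sup>2) p :> (1 / \<alpha>) *\<^sub>R (p - w)"
      unfolding gderiv_def power2_norm_eq_inner
      by (rule derivative_eq_intros refl | simp add: inner_commute algebra_simps fun_eq_iff)+
    then have "a - ((1 / \<alpha>) *\<^sub>R (p - w)) \<bullet> (y - p) \<le> r"
    proof (rule convex_min_sum_imp_subgradient[OF cvx _ hpa _ that])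
      fix y r assume "h y \<le> ereal r"
      from min[OF this] show "a + 1 / (2 * \<alpha>) * (norm (p - w))\<^sup>2 \<le> r + 1 / (2 * \<alpha>) * (norm (y - w))\<^sup>2"
        using \<alpha> mult_left_mono[of "J (p, a)" "J (y, r)" "1 / \<alpha>"]
        by (simp add: J_def distrib_left)
    qed
    then have "\<alpha> * (a - ((1 / \<alpha>) *\<^sub>R (p - w)) \<bullet> (y - p)) \<le> \<alpha> * r"
      using \<alpha> by simp
    then show ?thesis using \<alpha> by (simp add: right_diff_distrib inner_diff_left)
  qed
  ultimately show ?thesis by (rule that)
qed

text \<open>\<open>\<kappa> w\<close> is \<open>\<alpha>\<close> times the value of \<open>h\<close> at the proximal point of \<open>w\<close>.\<close>

lemma prox_resolvent:
  fixes h :: "'a::euclidean_space \<Rightarrow> ereal"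
  assumes cvx: "convex (ereal_epigraph h)" and cl: "closed (ereal_epigraph h)"
    and \<alpha>: "0 < \<alpha>" and ninf: "\<And>y. h y \<noteq> -\<infinity>" and x0: "h x0 = ereal a0"
    and minor: "\<And>y r. h y \<le> ereal r \<Longrightarrow> a0 + v \<bullet> (y - x0) \<le> r"
  obtains \<kappa> where
    "\<And>w w'. \<kappa> w + (w - prox \<alpha> h w) \<bullet> (prox \<alpha> h w' - prox \<alpha> h w) \<le> \<kappa> w'"
proof -
  have "\<exists>a. h (prox \<alpha> h w) = ereal a \<and> (\<forall>y r. h y \<le> ereal r \<longrightarrow>
      \<alpha> * a + (w - prox \<alpha> h w) \<bullet> (y - prox \<alpha> h w) \<le> \<alpha> * r)" for w
  proof -
    obtain p a where pa: "h p = ereal a"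
      "\<And>y r. h y \<le> ereal r \<Longrightarrow> \<alpha> * a + (w - p) \<bullet> (y - p) \<le> \<alpha> * r"
      using prox_minimizer_exists[OF assms] by blast
    moreover have "prox \<alpha> h w = p" using \<alpha> ninf pa by (rule prox_eqI)
    ultimately show ?thesis by blast
  qed
  then obtain k where k: "\<And>w. h (prox \<alpha> h w) = ereal (k w)"
    "\<And>w y r. h y \<le> ereal r \<Longrightarrow> \<alpha> * k w + (w - prox \<alpha> h w) \<bullet> (y - prox \<alpha> h w) \<le> \<alpha> * r"
    by metis
  show ?thesis by (rule that[of "\<lambda>w. \<alpha> * k w"]) (rule k(2), simp add: k(1))
qed

section \<open>Resolvents and the derivatives of their compositions\<close>

lemma resolvent_firmly_nonexpansive:
  fixes q :: "'a::real_inner \<Rightarrow> 'a"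
  assumes "\<And>w w'. \<kappa> w + (w - q w) \<bullet> (q w' - q w) \<le> \<kappa> w'"
  shows "(q w - q w') \<bullet> (q w - q w') \<le> (w - w') \<bullet> (q w - q w')"
  using assms[of w w'] assms[of w' w]
  by (simp add: inner_diff_left inner_diff_right inner_commute)

lemma resolvent_nonexpansive:
  fixes q :: "'a::real_inner \<Rightarrow> 'a"
  assumes "\<And>w w'. \<kappa> w + (w - q w) \<bullet> (q w' - q w) \<le> \<kappa> w'"
  shows "norm (q w - q w') \<le> norm (w - w')"
proof -
  have "(norm (q w - q w'))\<^sup>2 \<le> norm (w - w') * norm (q w - q w')"
    using resolvent_firmly_nonexpansive[of \<kappa> q, OF assms, of w w'] norm_cauchy_schwarz[of "w - w'" "q w - q w'"]
    by (simp add: power2_norm_eq_inner)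
  then show ?thesis
    by (cases "q w = q w'") (simp_all add: power2_eq_square)
qed

text \<open>The potential is the conjugate of \<open>\<alpha> h + \<parallel>\<cdot>\<parallel>\<^sup>2 / 2\<close>.\<close>

lemma resolvent_is_gradient:
  fixes q :: "'a::real_inner \<Rightarrow> 'a"
  assumes r: "\<And>w w'. \<kappa> w + (w - q w) \<bullet> (q w' - q w) \<le> \<kappa> w'"
  shows "GDERIV (\<lambda>w. w \<bullet> q w - \<kappa> w - (q w \<bullet> q w) / 2) w :> q w"
proof -
  let ?P = "\<lambda>w. w \<bullet> q w - \<kappa> w - (q w \<bullet> q w) / 2"
  have lower: "q w \<bullet> (w' - w) \<le> ?P w' - ?P w" for w w'
    using r[of w' w] inner_ge_zero[of "q w - q w'"]
    by (simp add: inner_diff_left inner_diff_right inner_commute field_simps)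
  \<comment> \<open>\<open>q w\<close> is a subgradient of the potential. Exchanging the two points
    bounds the remainder from above, and nonexpansiveness makes it quadratic.\<close>
  have "\<bar>?P w' - ?P w - (w' - w) \<bullet> q w\<bar> \<le> norm (w' - w) * norm (w' - w)" for w'
  proof -
    have "?P w' - ?P w - (w' - w) \<bullet> q w \<le> (q w' - q w) \<bullet> (w' - w)"
      using lower[of w' w] by (simp add: inner_diff_left inner_diff_right inner_commute)
    also have "\<dots> \<le> norm (q w' - q w) * norm (w' - w)" by (rule norm_cauchy_schwarz)
    also have "\<dots> \<le> norm (w' - w) * norm (w' - w)"
      using resolvent_nonexpansive[of \<kappa> q, OF r] by (intro mult_right_mono) auto
    finally show ?thesis using lower[of w w'] by (simp add: inner_commute)
  qed
  note bound = this
  show ?thesis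
    unfolding gderiv_def
  proof (rule has_derivativeI_sandwich[of 1])
    show "bounded_linear (\<lambda>h. h \<bullet> q w)" by (rule bounded_linear_inner_left)
    show "norm (?P y - ?P w - (y - w) \<bullet> q w) / norm (y - w) \<le> norm (y - w)" if "y \<noteq> w" for y
      using bound[of y] that by (simp add: field_simps)
    show "((\<lambda>y. norm (y - w)) \<longlongrightarrow> 0) (at w)"
      by (rule tendsto_eq_intros refl | simp)+
  qed simp
qed

text \<open>Firm nonexpansiveness passes to the limit in difference quotients of \<open>w\<close>
  and \<open>q\<close> after \<open>w\<close>; \<open>q\<close> itself is never
  differentiated.\<close>

lemma has_derivative_firm:
  fixes q :: "'a::real_inner \<Rightarrow> 'a" and w :: "'b::real_normed_vector \<Rightarrow> 'a"
  assumes firm: "\<And>w w'. (q w - q w') \<bullet> (q w - q w') \<le> (w - w') \<bullet> (q w - q w')"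
    and w: "(w has_derivative B) (at x)" and qw: "((\<lambda>y. q (w y)) has_derivative R) (at x)"
  shows "R s \<bullet> R s \<le> B s \<bullet> R s"
proof -
  let ?a = "\<lambda>t::real. (1 / t) *\<^sub>R (q (w (x + t *\<^sub>R s)) - q (w x))"
  let ?b = "\<lambda>t::real. (1 / t) *\<^sub>R (w (x + t *\<^sub>R s) - w x)"
  have l: "(?a \<longlongrightarrow> R s) (at 0)" "(?b \<longlongrightarrow> B s) (at 0)"
    by (rule has_derivative_directional[OF qw] has_derivative_directional[OF w])+
  have "((\<lambda>t. ?b t \<bullet> ?a t) \<longlongrightarrow> B s \<bullet> R s) (at 0)" "((\<lambda>t. ?a t \<bullet> ?a t) \<longlongrightarrow> R s \<bullet> R s) (at 0)"
    by (rule tendsto_inner[OF l(2,1)] tendsto_inner[OF l(1,1)])+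
  moreover have "?a t \<bullet> ?a t \<le> ?b t \<bullet> ?a t" for t
    using firm[of "w (x + t *\<^sub>R s)" "w x"]
    by (auto simp: divide_right_mono)
  ultimately show ?thesis
    by (intro tendsto_le[OF trivial_limit_at]) auto
qed

text \<open>\<open>q\<close> need not be differentiable at \<open>w x\<close> (\<open>B\<close> may be singular). But \<open>q\<close> composed with the
  linearization of \<open>w\<close> has the same derivative \<open>R\<close>, and \<open>B\<close> times it is a gradient field.\<close>

lemma resolvent_derivative_symmetric:
  fixes q :: "'a::euclidean_space \<Rightarrow> 'a"
  assumes r: "\<And>w w'. \<kappa> w + (w - q w) \<bullet> (q w' - q w) \<le> \<kappa> w'"
    and w: "(w has_derivative B) (at x)" and qw: "((\<lambda>y. q (w y)) has_derivative R) (at x)"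
    and symB: "\<And>u v. B u \<bullet> v = u \<bullet> B v"
  shows "B u \<bullet> R v = B v \<bullet> R u"
proof -
  define l where "l y = w x + B (y - x)" for y
  have lB: "(l has_derivative B) (at y)" for y
  proof -
    have "((\<lambda>y. y - x) has_derivative (\<lambda>h. h)) (at y)"
      by (auto intro!: derivative_eq_intros)
    from has_derivative_add[OF has_derivative_const bounded_linear.has_derivative[OF
        has_derivative_bounded_linear[OF w] this]]
    show ?thesis by (simp add: l_def[abs_def])
  qed
  \<comment> \<open>\<open>q\<close> is nonexpansive, so replacing \<open>w\<close> by its
    linearization changes the value by o(norm (y - x)).\<close>
  have qd: "((\<lambda>y. q (l y)) has_derivative R) (at x)"
  proof -
    have "((\<lambda>y. q (l y) - q (w y)) has_derivative (\<lambda>h. 0)) (at x)"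
    proof (rule has_derivativeI_sandwich[of 1])
      show "norm (q (l y) - q (w y) - (q (l x) - q (w x)) - 0) / norm (y - x)
          \<le> norm ((w y - w x) - B (y - x)) / norm (y - x)" for y
        using resolvent_nonexpansive[of \<kappa> q, OF r, of "l y" "w y"]
          linear_0[OF has_derivative_linear[OF w]]
        by (intro divide_right_mono) (simp_all add: l_def norm_minus_commute algebra_simps)
      show "((\<lambda>y. norm ((w y - w x) - B (y - x)) / norm (y - x)) \<longlongrightarrow> 0) (at x)"
        using w by (simp add: has_derivative_iff_norm)
    qed simp_all
    from has_derivative_add[OF this qw] show ?thesis by simp
  qed
  \<comment> \<open>The chain rule with an affine inner map: the outer factor is the adjoint of
    \<open>B\<close>, which is \<open>B\<close>. Differentiating this gradient at \<open>x\<close>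
    shows that \<open>B R\<close> is symmetric.\<close>
  have "GDERIV (\<lambda>y. (\<lambda>w. w \<bullet> q w - \<kappa> w - (q w \<bullet> q w) / 2) (l y)) y :> B (q (l y))" for y
    unfolding gderiv_def
    using has_derivative_compose[OF lB resolvent_is_gradient[of \<kappa> q, OF r, unfolded gderiv_def]]
    by (simp add: symB)
  moreover have "((\<lambda>y. B (q (l y))) has_derivative (\<lambda>h. B (R h))) (at x)"
    by (rule bounded_linear.has_derivative[OF has_derivative_bounded_linear[OF w] qd])
  ultimately have "B (R u) \<bullet> v = B (R v) \<bullet> u"
    by (rule gradient_derivative_symmetric)
  then show ?thesis by (simp add: symB inner_commute)
qed

section \<open>Tangent spaces\<close>

lemma C1_on_subset: "C1_on S F \<Longrightarrow> open T \<Longrightarrow> T \<subseteq> S \<Longrightarrow> C1_on T F"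
  unfolding C1_on_def by (meson continuous_on_subset subset_iff)

text \<open>Serves twice: to restrict a map to a line, and to restrict \<open>apg_map\<close> to the
  diagonal of its two iterates.\<close>

lemma C1_on_compose_affine:
  assumes "C1_on S F"
  shows "C1_on {x. a + blinfun_apply A x \<in> S} (\<lambda>x. F (a + blinfun_apply A x))"
proof -
  obtain F' where S: "open S" and F: "\<And>x. x \<in> S \<Longrightarrow> (F has_derivative blinfun_apply (F' x)) (at x)"
    and F': "continuous_on S F'"
    using assms unfolding C1_on_def by blast
  have cont: "continuous_on T (\<lambda>x. a + blinfun_apply A x)" for T
    by (intro continuous_intros)
  have "open {x. a + blinfun_apply A x \<in> S}"
    using open_vimage[OF S, of "\<lambda>x. a + blinfun_apply A x"] cont by (simp add: vimage_def)
  moreover have "((\<lambda>x. F (a + blinfun_apply A x)) has_derivative blinfun_apply (F' (a + A x) o\<^sub>L A)) (at x)"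
    if "a + blinfun_apply A x \<in> S" for x
  proof -
    have "((\<lambda>x. a + blinfun_apply A x) has_derivative blinfun_apply A) (at x)"
      by (auto intro!: derivative_eq_intros)
    from has_derivative_compose[OF this F[OF that]] show ?thesis
      by (simp add: blinfun_compose.rep_eq o_def)
  qed
  moreover have "continuous_on {x. a + blinfun_apply A x \<in> S} (\<lambda>x. F' (a + A x) o\<^sub>L A)"
    by (intro continuous_intros continuous_on_compose2[OF F' cont]) auto
  ultimately show ?thesis
    unfolding C1_on_def by (intro conjI exI[of _ "\<lambda>x. F' (a + A x) o\<^sub>L A"] ballI) simp_all
qed

lemma C1_on_blinfun_compose:
  assumes "C1_on S F"
  shows "C1_on S (\<lambda>x. blinfun_apply B (F x))"
proof -
  obtain F' where S: "open S" and F: "\<And>x. x \<in> S \<Longrightarrow> (F has_derivative blinfun_apply (F' x)) (at x)"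
    and F': "continuous_on S F'"
    using assms unfolding C1_on_def by blast
  have "((\<lambda>x. blinfun_apply B (F x)) has_derivative blinfun_apply (B o\<^sub>L F' x)) (at x)" if "x \<in> S" for x
    using bounded_linear.has_derivative[OF blinfun.bounded_linear_right F[OF that]]
    by (simp add: blinfun_compose.rep_eq o_def)
  moreover have "continuous_on S (\<lambda>x. B o\<^sub>L F' x)"
    by (intro continuous_intros F')
  ultimately show ?thesis
    unfolding C1_on_def using S by (intro conjI exI[of _ "\<lambda>x. B o\<^sub>L F' x"] ballI) simp_all
qed

text \<open>The image of a line segment is the required curve. Values in \<open>M\<close> are
  demanded on the line alone, because an inverse chart maps only a slice into
  \<open>M\<close>.\<close>

lemma derivative_in_tangent_space:
  assumes F: "C1_on S F" and a: "a \<in> S" and M: "\<And>t. a + t *\<^sub>R b \<in> S \<Longrightarrow> F (a + t *\<^sub>R b) \<in> M"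
    and D: "(F has_derivative D) (at a)"
  shows "D b \<in> tangent_space M (F a)"
proof -
  define I where "I = {t::real. a + blinfun_apply (blinfun_scaleR_left b) t \<in> S}"
  have C: "C1_on I (\<lambda>t. F (a + t *\<^sub>R b))"
    using C1_on_compose_affine[OF F, of a "blinfun_scaleR_left b"] by (simp add: I_def)
  then have "open I" by (simp add: C1_on_def)
  moreover have "0 \<in> I" using a by (simp add: I_def)
  ultimately obtain e where e: "0 < e" "ball 0 e \<subseteq> I"
    using open_contains_ball by blast
  have sub: "{-e<..<e} \<subseteq> I" using e(2) by (auto simp: subset_iff dist_real_def)
  have "((\<lambda>t. a + t *\<^sub>R b) has_derivative (\<lambda>t. t *\<^sub>R b)) (at 0)"
    by (auto intro!: derivative_eq_intros)
  then have "((\<lambda>t. F (a + t *\<^sub>R b)) has_derivative (\<lambda>t. D (t *\<^sub>R b))) (at 0)"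
    using has_derivative_compose[of "\<lambda>t. a + t *\<^sub>R b" _ 0 UNIV F D] D by simp
  then have "((\<lambda>t. F (a + t *\<^sub>R b)) has_vector_derivative D b) (at 0)"
    by (simp add: has_vector_derivative_def linear_scale[OF has_derivative_linear[OF D]])
  moreover have "C1_on {-e<..<e} (\<lambda>t. F (a + t *\<^sub>R b))" by (rule C1_on_subset[OF C _ sub]) simp
  moreover have "(\<lambda>t. F (a + t *\<^sub>R b)) ` {-e<..<e} \<subseteq> M"
    using sub M by (auto simp: I_def)
  ultimately show ?thesis
    unfolding tangent_space_def using e(1)
    by (intro CollectI exI[of _ "\<lambda>t. F (a + t *\<^sub>R b)"] exI[of _ e]) simp
qed

lemma C2_on_imp_C1_on: "C2_on S F \<Longrightarrow> C1_on S F"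
proof -
  assume "C2_on S F"
  then obtain F' where "\<And>x. x \<in> S \<Longrightarrow> (F has_derivative blinfun_apply (F' x)) (at x)" "C1_on S F'"
    unfolding C2_on_def by blast
  moreover have "continuous_on S F'"
    using \<open>C1_on S F'\<close> unfolding C1_on_def
    by (meson continuous_at_imp_continuous_on has_derivative_continuous)
  ultimately show "C1_on S F" unfolding C1_on_def by blast
qed

text \<open>Velocities of curves have no evident sum. In a straightening chart they become the
  preimage of \<open>E\<close> under the derivative \<open>A\<close>: difference quotients stay in
  the closed set \<open>E\<close>, and conversely lines in \<open>E\<close> are pulled back to
  curves in \<open>M\<close>.\<close>

lemma subspace_tangent_space:
  fixes M :: "'a::euclidean_space set"
  assumes "C2_submanifold M" "x \<in> M"
  shows "subspace (tangent_space M x)"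
proof -
  obtain U V \<phi> \<phi>' and E :: "'a set" where x: "x \<in> U" and hom: "homeomorphism U V \<phi> \<phi>'"
    and C: "C2_on U \<phi>" "C2_on V \<phi>'" and E: "subspace E" and img: "\<phi> ` (U \<inter> M) = V \<inter> E"
    using assms unfolding C2_submanifold_def by metis
  note C1 = C[THEN C2_on_imp_C1_on]
  obtain A where A: "(\<phi> has_derivative A) (at x)" and U: "open U"
    using C1(1) x unfolding C1_on_def by blast
  have inv: "\<And>y. y \<in> U \<Longrightarrow> \<phi>' (\<phi> y) = y" using hom by (auto simp: homeomorphism_def)
  have V: "\<phi> x \<in> V" using hom x by (auto simp: homeomorphism_def)
  have xE: "\<phi> x \<in> E" using img x assms(2) by blast
  obtain B where B: "(\<phi>' has_derivative B) (at (\<phi> x))"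
    using C1(2) V unfolding C1_on_def by blast
  have BA: "B (A v) = v" for v
  proof -
    have "((\<lambda>y. \<phi>' (\<phi> y)) has_derivative (\<lambda>v. B (A v))) (at x)"
      by (rule has_derivative_compose[OF A B])
    then have "((\<lambda>y. y) has_derivative (\<lambda>v. B (A v))) (at x)"
      by (rule has_derivative_transform_within_open[OF _ U x inv])
    then have "(\<lambda>v. B (A v)) = (\<lambda>v. v)" by (rule has_derivative_unique) (rule has_derivative_ident)
    then show ?thesis by metis
  qed
  have "tangent_space M x = {v. A v \<in> E}"
  proof (intro set_eqI iffI CollectI)
    fix v assume "v \<in> tangent_space M x"
    then obtain \<gamma> e where g: "0 < e" "\<gamma> ` {-e<..<e} \<subseteq> M" "\<gamma> (0::real) = x"
      "(\<gamma> has_vector_derivative v) (at 0)"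
      unfolding tangent_space_def by blast
    have "(\<gamma> has_derivative (\<lambda>t. t *\<^sub>R v)) (at 0)" using g(4) by (simp add: has_vector_derivative_def)
    moreover have "(\<phi> has_derivative A) (at (\<gamma> 0))" using A g(3) by simp
    ultimately have "((\<lambda>t. \<phi> (\<gamma> t)) has_derivative (\<lambda>t. A (t *\<^sub>R v))) (at 0)"
      by (rule has_derivative_compose)
    from has_derivative_directional[OF this, of 1]
    have lim: "((\<lambda>t. (1 / t) *\<^sub>R (\<phi> (\<gamma> t) - \<phi> x)) \<longlongrightarrow> A v) (at 0)"
      by (simp add: g(3))
    have "isCont \<gamma> 0" using g(4) has_vector_derivative_continuous by blast
    then have "\<forall>\<^sub>F t in at 0. \<gamma> t \<in> U"
      using U x g(3) by (auto simp: isCont_def intro: topological_tendstoD)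
    moreover have "\<forall>\<^sub>F t in at (0::real). t \<in> {-e<..<e}"
      using g(1) by (intro eventually_at_in_open') auto
    ultimately have "\<forall>\<^sub>F t in at 0. (1 / t) *\<^sub>R (\<phi> (\<gamma> t) - \<phi> x) \<in> E"
    proof eventually_elim
      case (elim t)
      then have "\<phi> (\<gamma> t) \<in> E" using g(2) img by blast
      then show ?case using E xE by (intro subspace_scale subspace_diff)
    qed
    then show "A v \<in> E"
      using closed_subspace[OF E] lim by (intro Lim_in_closed_set[of E _ "at 0"]) auto
  next
    fix v assume "v \<in> {v. A v \<in> E}"
    then have v: "A v \<in> E" by simp
    have "B (A v) \<in> tangent_space M (\<phi>' (\<phi> x))"
    proof (rule derivative_in_tangent_space[OF C1(2) V _ B])
      fix t assume "\<phi> x + t *\<^sub>R A v \<in> V"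
      moreover have "\<phi> x + t *\<^sub>R A v \<in> E" using E xE v by (intro subspace_add subspace_scale)
      ultimately obtain m where "m \<in> U \<inter> M" "\<phi> x + t *\<^sub>R A v = \<phi> m" using img by blast
      then show "\<phi>' (\<phi> x + t *\<^sub>R A v) \<in> M" using inv by simp
    qed
    then show "v \<in> tangent_space M x" using BA inv x by simp
  qed
  then show ?thesis
    using linear_subspace_vimage[OF has_derivative_linear[OF A] E] by (simp add: vimage_def)
qed

text \<open>Removes the projection from (RPD-ii) when the Hessian is tested with tangent
  vectors.\<close>

lemma inner_orth_proj:
  assumes "subspace T" "v \<in> T"
  shows "v \<bullet> orth_proj T w = v \<bullet> w"
proof -
  obtain p n where "p \<in> span T" "\<And>t. t \<in> span T \<Longrightarrow> orthogonal n t" "w = p + n"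
    using orthogonal_subspace_decomp_exists[of T w] by metis
  then have p: "p \<in> T" "w - p \<in> T\<^sup>\<bottom>"
    using assms(1) by (auto simp: span_eq_iff[THEN iffD2, OF assms(1)] orthogonal_comp_def orthogonal_commute)
  have "orth_proj T w = p"
    unfolding orth_proj_def
  proof (rule the_equality)
    fix p' assume p': "p' \<in> T \<and> w - p' \<in> T\<^sup>\<bottom>"
    then have "p' - p \<in> T" using p assms(1) by (simp add: subspace_diff)
    then have "(p' - p) \<bullet> (w - p) = 0" "(p' - p) \<bullet> (w - p') = 0"
      using p p' by (auto simp: orthogonal_comp_def orthogonal_def)
    then have "(p' - p) \<bullet> (p' - p) = 0" by (simp add: inner_diff_right)
    then show "p' = p" by simp
  qed (use p in simp)
  then show ?thesis
    using p(2) assms(2) by (simp add: orthogonal_comp_def orthogonal_def inner_diff_right)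
qed

section \<open>Partial gradients and the proximal gradient map\<close>

lemma C2_on_partial_grad:
  fixes f :: "'x::euclidean_space \<times> 'u::euclidean_space \<Rightarrow> real"
  assumes "C2_on UNIV f"
  shows "GDERIV (\<lambda>x. f (x, u)) x :> grad (\<lambda>x. f (x, u)) x"
    and "(grad (\<lambda>x. f (x, u)) has_derivative hess (\<lambda>x. f (x, u)) x) (at x)"
proof -
  obtain f' where f': "\<And>p. (f has_derivative blinfun_apply (f' p)) (at p)" and C: "C1_on UNIV f'"
    using assms unfolding C2_on_def by blast
  obtain f'' where f'': "\<And>p. (f' has_derivative blinfun_apply (f'' p)) (at p)"
    using C unfolding C1_on_def by blast
  define G where "G x = (\<Sum>b\<in>Basis. blinfun_apply (f' (x, u)) (b, 0) *\<^sub>R b)" for x :: 'x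
  have pair: "((\<lambda>x. (x, u)) has_derivative (\<lambda>h. (h, 0))) (at x)" for x :: 'x
    by (auto intro!: derivative_eq_intros)
  have G: "GDERIV (\<lambda>x. f (x, u)) x :> G x" for x
  proof -
    have lin: "linear (\<lambda>h::'x. blinfun_apply (f' (x, u)) (h, 0))"
    proof (rule linearI)
      fix r :: real and a b :: 'x
      show "f' (x, u) (a + b, 0) = f' (x, u) (a, 0) + f' (x, u) (b, 0)"
        using blinfun.add_right[of "f' (x, u)" "(a, 0)" "(b, 0)"] by simp
      show "f' (x, u) (r *\<^sub>R b, 0) = r *\<^sub>R f' (x, u) (b, 0)"
        using blinfun.scaleR_right[of "f' (x, u)" r "(b, 0)"] by simp
    qed
    have "blinfun_apply (f' (x, u)) (\<Sum>b\<in>Basis. (h \<bullet> b) *\<^sub>R b, 0) = h \<bullet> G x" for h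
      unfolding linear_sum[OF lin] linear_scale[OF lin]
      by (simp add: G_def inner_sum_right mult.commute)
    then have "h \<bullet> G x = blinfun_apply (f' (x, u)) (h, 0)" for h
      by (simp add: euclidean_representation)
    moreover have "((\<lambda>x. f (x, u)) has_derivative (\<lambda>h. blinfun_apply (f' (x, u)) (h, 0))) (at x)"
      by (rule has_derivative_compose[OF pair f'])
    ultimately show ?thesis by (simp add: gderiv_def)
  qed
  have grad: "grad (\<lambda>x. f (x, u)) = G"
  proof
    fix x
    show "grad (\<lambda>x. f (x, u)) x = G x"
      unfolding grad_def
    proof (rule the_equality[where P = "\<lambda>D. GDERIV (\<lambda>x. f (x, u)) x :> D", OF G])
      fix D assume "GDERIV (\<lambda>x. f (x, u)) x :> D"
      with G[of x] have "(\<lambda>h. h \<bullet> D) = (\<lambda>h. h \<bullet> G x)"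
        unfolding gderiv_def by (blast intro: has_derivative_unique)
      then show "D = G x" by (metis vector_eq_ldot)
    qed
  qed
  then show "GDERIV (\<lambda>x. f (x, u)) x :> grad (\<lambda>x. f (x, u)) x" using G by simp
  have "((\<lambda>x. f' (x, u)) has_derivative (\<lambda>h. f'' (x, u) (h, 0))) (at x)"
    by (rule has_derivative_compose[OF pair f''])
  then have "(G has_derivative (\<lambda>h. \<Sum>b\<in>Basis. blinfun_apply (f'' (x, u) (h, 0)) (b, 0) *\<^sub>R b)) (at x)"
    unfolding G_def[abs_def] by (auto intro!: derivative_eq_intros)
  then have "(G has_derivative frechet_derivative G (at x)) (at x)"
    using differentiableI frechet_derivative_works by blast
  then show "(grad (\<lambda>x. f (x, u)) has_derivative hess (\<lambda>x. f (x, u)) x) (at x)"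
    unfolding hess_def grad .
qed

lemma lsc_slice_closed_epigraph:
  fixes g :: "'x::euclidean_space \<times> 'u::euclidean_space \<Rightarrow> ereal"
  assumes "lsc g"
  shows "closed (ereal_epigraph (\<lambda>x. g (x, u)))"
  unfolding closed_sequential_limits
proof (intro allI impI, elim conjE)
  fix z :: "nat \<Rightarrow> 'x \<times> real" and l
  assume z: "\<forall>n. z n \<in> ereal_epigraph (\<lambda>x. g (x, u))" "z \<longlonglongrightarrow> l"
  have "g (fst l, u) \<le> ereal (snd l)"
  proof (rule ccontr)
    assume "\<not> g (fst l, u) \<le> ereal (snd l)"
    then have "ereal (snd l) < g (fst l, u)" by simp
    from dense[OF this] obtain c where c: "ereal (snd l) < c" "c < g (fst l, u)" by blast
    have "\<forall>\<^sub>F y in at (fst l, u). c < g y"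
      using assms c(2) unfolding lsc_def le_Liminf_iff by blast
    \<comment> \<open>\<open>lsc\<close> speaks of punctured neighbourhoods, but the sequence may
      hit its limit, so the point itself is added.\<close>
    then have "\<forall>\<^sub>F y in nhds (fst l, u). c < g y"
      using c(2) by (simp add: eventually_nhds_conv_at)
    moreover have "(\<lambda>n. (fst (z n), u)) \<longlonglongrightarrow> (fst l, u)"
      by (intro tendsto_intros z(2))
    ultimately have "\<forall>\<^sub>F n in sequentially. c < g (fst (z n), u)"
      by (rule eventually_compose_filterlim)
    moreover have "(\<lambda>n. ereal (snd (z n))) \<longlonglongrightarrow> ereal (snd l)"
      by (intro tendsto_intros z(2))
    then have "\<forall>\<^sub>F n in sequentially. ereal (snd (z n)) < c" by (rule order_tendstoD) (rule c(1))
    ultimately have "\<forall>\<^sub>F n in sequentially. False"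
    proof eventually_elim
      case (elim n)
      have "g (fst (z n), u) \<le> ereal (snd (z n))"
        using z(1) by (auto simp: ereal_epigraph_def split_beta dest: spec[of _ n])
      with elim show False by (meson less_le_trans less_trans less_irrefl le_less_trans)
    qed
    then show False by simp
  qed
  then show "l \<in> ereal_epigraph (\<lambda>x. g (x, u))" by (simp add: ereal_epigraph_def split_beta)
qed

text \<open>(ND) makes \<open>x\<close> a minimizer of the objective. As the smooth part is
  differentiable at \<open>x\<close> and the slice of \<open>g\<close> is convex, the negative
  gradient is a global subgradient of that slice.\<close>

lemma ND_imp_gradient_subgradient:
  fixes f :: "'x::euclidean_space \<times> 'u::euclidean_space \<Rightarrow> real"
  assumes f: "C2_on UNIV f" and cvx: "convex (ereal_epigraph (\<lambda>x. g (x, u)))"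
    and nd: "ND f g x u"
  obtains a where "g (x, u) = ereal a"
    "\<And>y r. g (y, u) \<le> ereal r \<Longrightarrow> a + (- grad (\<lambda>x. f (x, u)) x) \<bullet> (y - x) \<le> r"
proof -
  have "0 \<in> convex_subdiff (\<lambda>y. objective f g (y, u)) x"
    using nd rel_interior_subset unfolding ND_def by blast
  then have fin: "\<bar>objective f g (x, u)\<bar> \<noteq> \<infinity>"
    and min: "\<And>y. objective f g (x, u) \<le> objective f g (y, u)"
    by (auto simp: convex_subdiff_def zero_ereal_def[symmetric])
  then obtain a where a: "g (x, u) = ereal a"
    by (cases "g (x, u)") (auto simp: objective_def)
  have "a - (grad (\<lambda>x. f (x, u)) x) \<bullet> (y - x) \<le> r" if y: "g (y, u) \<le> ereal r" for y r
  proof (rule convex_min_sum_imp_subgradient[OF cvx C2_on_partial_grad(1)[OF f] _ _ y])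
    fix y r assume "g (y, u) \<le> ereal r"
    then have "objective f g (y, u) \<le> ereal (f (y, u)) + ereal r"
      unfolding objective_def by (rule add_left_mono)
    with min[of y] have "ereal (f (x, u)) + ereal a \<le> ereal (f (y, u)) + ereal r"
      unfolding objective_def a by (rule order_trans)
    then show "a + f (x, u) \<le> r + f (y, u)" by simp
  qed (simp add: a)
  then show ?thesis using a by (intro that[of a]) auto
qed

lemma ND_imp_pg_map_fixed:
  fixes f :: "'x::euclidean_space \<times> 'u::euclidean_space \<Rightarrow> real"
  assumes f: "C2_on UNIV f" and cvx: "convex (ereal_epigraph (\<lambda>x. g (x, u)))"
    and nd: "ND f g x u" and \<alpha>: "0 < \<alpha>" and ninf: "\<And>y. g (y, u) \<noteq> -\<infinity>"
  shows "pg_map f g \<alpha> x u = x"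
proof -
  obtain a where a: "g (x, u) = ereal a"
    "\<And>y r. g (y, u) \<le> ereal r \<Longrightarrow> a + (- grad (\<lambda>x. f (x, u)) x) \<bullet> (y - x) \<le> r"
    using ND_imp_gradient_subgradient[where f = f and g = g, OF f cvx nd] by blast
  show ?thesis
    unfolding pg_map_def
  proof (rule prox_eqI[where a = a])
    fix y r assume "g (y, u) \<le> ereal r"
    from mult_left_mono[OF a(2)[OF this], of \<alpha>] \<alpha>
    show "\<alpha> * a + (x - \<alpha> *\<^sub>R grad (\<lambda>y. f (y, u)) x - x) \<bullet> (y - x) \<le> \<alpha> * r"
      by (simp flip: right_diff_distrib)
  qed (use \<alpha> ninf a in auto)
qed

section \<open>Linearization of the proximal gradient map at the solution\<close>

lemma apg_neighbourhood_imp_C1_pg_map: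
  fixes V :: "(('x::euclidean_space \<times> 'x) \<times> 'u::euclidean_space \<times> real) set"
  assumes "apg_neighbourhood f g M \<Omega> L xs us as V"
  obtains W where "(xs, us, as) \<in> W" "C1_on W (\<lambda>(x, u, a). pg_map f g a x u)"
    "\<And>x u a. (x, u, a) \<in> W \<Longrightarrow> pg_map f g a x u \<in> M"
proof -
  \<comment> \<open>The diagonal embedding. With \<open>\<beta> = 0\<close> there is no
    extrapolation, so the first component of \<open>apg_map\<close> is \<open>pg_map\<close>,
    jointly C1 in point, parameter and step size.\<close>
  define A :: "('x \<times> 'u \<times> real) \<Rightarrow>\<^sub>L (('x \<times> 'x) \<times> 'u \<times> real)"
    where "A = Blinfun (\<lambda>(x, u, a). ((x, x), u, a))"
  have "bounded_linear (\<lambda>(x::'x, u::'u, a::real). ((x, x), u, a))"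
    unfolding linear_conv_bounded_linear[symmetric] by (rule linearI) auto
  then have A: "A (x, u, a) = ((x, x), u, a)" for x u a
    by (simp add: A_def bounded_linear_Blinfun_apply)
  have C: "C1_on V (\<lambda>(z, u, \<alpha>). apg_map f g \<alpha> 0 z u)"
    and xs: "((xs, xs), us, as) \<in> V"
    and M: "\<And>z u \<alpha>. (z, u, \<alpha>) \<in> V \<Longrightarrow> apg_map f g \<alpha> 0 z u \<in> M \<times> UNIV"
    using assms unfolding apg_neighbourhood_def by (auto simp: Let_def dest: bspec[of _ _ 0])
  have "C1_on {p. 0 + A p \<in> V}
      (\<lambda>p. blinfun_apply fst_blinfun ((\<lambda>(z, u, \<alpha>). apg_map f g \<alpha> 0 z u) (0 + A p)))"
    by (intro C1_on_compose_affine C1_on_blinfun_compose C)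
  moreover have "(\<lambda>p. blinfun_apply fst_blinfun ((\<lambda>(z, u, \<alpha>). apg_map f g \<alpha> 0 z u) (0 + A p)))
      = (\<lambda>(x, u, a). pg_map f g a x u)"
    by (auto simp: fun_eq_iff A apg_map_def extrapolate_def fst_blinfun.rep_eq)
  ultimately have "C1_on {p. A p \<in> V} (\<lambda>(x, u, a). pg_map f g a x u)" by simp
  moreover have "(xs, us, as) \<in> {p. A p \<in> V}" using xs by (simp add: A)
  moreover have "pg_map f g a x u \<in> M" if "(x, u, a) \<in> {p. A p \<in> V}" for x u a
    using M[of "(x, x)" u a] that by (simp add: A apg_map_def extrapolate_def)
  ultimately show ?thesis by (intro that[of "{p. A p \<in> V}"]) auto
qed

lemma pg_map_partial_derivatives:
  assumes "((\<lambda>(x, u, a). pg_map f g a x u) has_derivative D) (at (x, u, a))"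
  shows "((\<lambda>x. pg_map f g a x u) has_derivative (\<lambda>h. D (h, 0, 0))) (at x)"
    and "((\<lambda>u. pg_map f g a x u) has_derivative (\<lambda>h. D (0, h, 0))) (at u)"
proof -
  have "((\<lambda>x. (x, u, a)) has_derivative (\<lambda>h. (h, 0, 0))) (at x)"
    "((\<lambda>u. (x, u, a)) has_derivative (\<lambda>h. (0, h, 0))) (at u)"
    by (auto intro!: derivative_eq_intros simp: zero_prod_def)
  from this[THEN has_derivative_compose, OF assms]
  show "((\<lambda>x. pg_map f g a x u) has_derivative (\<lambda>h. D (h, 0, 0))) (at x)"
    "((\<lambda>u. pg_map f g a x u) has_derivative (\<lambda>h. D (0, h, 0))) (at u)"
    by simp_all
qed

lemma pg_map_linearization:
  fixes f :: "'x::euclidean_space \<times> 'u::euclidean_space \<Rightarrow> real"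
  assumes sub: "C2_submanifold M" and \<Omega>: "us \<in> \<Omega>" and xs: "xs \<in> M"
    and cpso: "CPSO f g M \<Omega> L" and rpd: "RPD_ii f M xs us" and nd: "ND f g xs us"
    and nb: "apg_neighbourhood f g M \<Omega> L xs us as V"
  obtains B c where "prox_grad_linearization
    (frechet_derivative (\<lambda>x. pg_map f g as x us) (at xs)) B c"
proof -
  let ?fu = "\<lambda>x. f (x, us)" and ?h = "\<lambda>x. g (x, us)"
  let ?R = "frechet_derivative (\<lambda>x. pg_map f g as x us) (at xs)"
  have f: "C2_on UNIV f" and cvx: "convex (ereal_epigraph ?h)"
    using cpso \<Omega> by (auto simp: CPSO_def)
  have "partly_smooth_at g (M \<times> \<Omega>) (xs, us)"
    using cpso xs \<Omega> by (auto simp: CPSO_def partly_smooth_def)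
  then have ninf: "?h y \<noteq> -\<infinity>" and lsc: "lsc g" for y
    by (auto simp: partly_smooth_at_def proper_fun_def)
  note cl = lsc_slice_closed_epigraph[OF lsc, of us]
  have as_pos: "0 < as" using nb by (auto simp: apg_neighbourhood_def)
  obtain W where W: "(xs, us, as) \<in> W" and C: "C1_on W (\<lambda>(x, u, a). pg_map f g a x u)"
    and WM: "\<And>x u a. (x, u, a) \<in> W \<Longrightarrow> pg_map f g a x u \<in> M"
    using apg_neighbourhood_imp_C1_pg_map[OF nb] by blast
  obtain D where D: "((\<lambda>(x, u, a). pg_map f g a x u) has_derivative blinfun_apply D) (at (xs, us, as))"
    using C W unfolding C1_on_def by blast
  note R' = pg_map_partial_derivatives(1)[OF D]
  have R: "((\<lambda>x. pg_map f g as x us) has_derivative ?R) (at xs)"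
    using R' frechet_derivative_at[OF R'] by simp
  have Req: "?R v = D (v, 0, 0)" for v using frechet_derivative_at[OF R'] by metis
  have fixed: "pg_map f g as xs us = xs"
    by (rule ND_imp_pg_map_fixed[OF f cvx nd as_pos ninf])
  define H where "H = hess ?fu xs"
  have H: "(grad ?fu has_derivative H) (at xs)"
    unfolding H_def by (rule C2_on_partial_grad(2)[OF f])
  note linH = has_derivative_linear[OF H]
  have symH: "H u \<bullet> v = H v \<bullet> u" for u v
    by (rule gradient_derivative_symmetric[OF C2_on_partial_grad(1)[OF f] H])
  define B where "B v = v - as *\<^sub>R H v" for v
  define w where "w x = x - as *\<^sub>R grad ?fu x" for x
  have w: "(w has_derivative B) (at xs)"
    unfolding w_def[abs_def] B_def[abs_def] by (auto intro!: derivative_eq_intros H)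
  have qw: "((\<lambda>x. prox as ?h (w x)) has_derivative ?R) (at xs)"
    using R by (simp add: pg_map_def[abs_def] w_def)
  have symB: "B u \<bullet> v = u \<bullet> B v" for u v
    using symH[of u v] by (simp add: B_def inner_diff_left inner_diff_right inner_commute)
  obtain a where a: "?h xs = ereal a"
    "\<And>y r. ?h y \<le> ereal r \<Longrightarrow> a + (- grad ?fu xs) \<bullet> (y - xs) \<le> r"
    using ND_imp_gradient_subgradient[where f = f and g = g, OF f cvx nd] by blast
  obtain \<kappa> where r: "\<And>w w'. \<kappa> w + (w - prox as ?h w) \<bullet> (prox as ?h w' - prox as ?h w) \<le> \<kappa> w'"
    using prox_resolvent[OF cvx cl as_pos ninf a] by blast
  \<comment> \<open>\<open>pg_map\<close> takes values in \<open>M\<close> near the solution;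
    \<open>fixed\<close> ensures that the base point of the tangent space is
    \<open>xs\<close>.\<close>
  have tangent: "?R v \<in> tangent_space M xs" for v
  proof -
    have "blinfun_apply D (v, 0, 0) \<in> tangent_space M ((\<lambda>(x, u, a). pg_map f g a x u) (xs, us, as))"
      by (rule derivative_in_tangent_space[OF C W _ D]) (use WM in auto)
    then show ?thesis by (simp add: Req fixed)
  qed
  have sT: "subspace (tangent_space M xs)" by (rule subspace_tangent_space[OF sub xs])
  have "0 < H v \<bullet> v" if "v \<in> tangent_space M xs" "v \<noteq> 0" for v
    using rpd that inner_orth_proj[OF sT that(1), of "H v"]
    by (auto simp: RPD_ii_def positive_definite_on_def H_def inner_commute)
  then obtain c where c: "0 < c" "\<And>s. s \<in> tangent_space M xs \<Longrightarrow> c * (s \<bullet> s) \<le> H s \<bullet> s"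
    using pos_on_subspace_imp_coercive[OF sT linH] by metis
  \<comment> \<open>The gap is the step size times the coercivity constant of the Hessian, since
    \<open>B s \<bullet> s = s \<bullet> s - as * (H s \<bullet> s)\<close> and \<open>?R\<close>
    has tangent values.\<close>
  have "prox_grad_linearization ?R B (as * c)"
  proof (rule prox_grad_linearization.intro)
    show "linear ?R" by (rule has_derivative_linear[OF R])
    show "linear B" by (rule has_derivative_linear[OF w])
    show "B u \<bullet> v = u \<bullet> B v" for u v by (rule symB)
    show "B u \<bullet> ?R v = B v \<bullet> ?R u" for u v
      by (rule resolvent_derivative_symmetric[where q = "prox as ?h" and \<kappa> = \<kappa>, OF r w qw symB])
    show "?R s \<bullet> ?R s \<le> B s \<bullet> ?R s" for s
      by (rule has_derivative_firm[where q = "prox as ?h",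
          OF resolvent_firmly_nonexpansive[where \<kappa> = \<kappa>, OF r] w qw])
    show "0 < as * c" using as_pos c by simp
    show "B (?R s) \<bullet> ?R s \<le> (1 - as * c) * (?R s \<bullet> ?R s)" for s
      using mult_left_mono[OF c(2)[OF tangent[of s]], of as] as_pos
      by (simp add: B_def inner_diff_left algebra_simps)
  qed
  then show ?thesis by (rule that)
qed

text \<open>(ND) holds along the whole solution map, so \<open>pg_map\<close> fixes
  \<open>\<psi> u\<close> for all \<open>u\<close> in \<open>U\<close>, and this identity can be
  differentiated. The last slot of \<open>D\<close> is 0 because the step size is frozen.\<close>

lemma solution_map_derivative_fixed_point:
  fixes f :: "'x::euclidean_space \<times> 'u::euclidean_space \<Rightarrow> real"
  assumes cpso: "CPSO f g M \<Omega> L" and xs: "xs \<in> M" and as_pos: "0 < as"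
    and sol: "local_solution_map f g M \<Omega> xs us U \<psi>"
    and D: "((\<lambda>(x, u, a). pg_map f g a x u) has_derivative D) (at (xs, us, as))"
  shows "D (frechet_derivative \<psi> (at us) du, du, 0) = frechet_derivative \<psi> (at us) du"
proof -
  have U: "open U" "us \<in> U" "U \<subseteq> \<Omega>" "\<psi> us = xs" and C: "C1_on U \<psi>"
    and nd: "\<And>u. u \<in> U \<Longrightarrow> ND f g (\<psi> u) u"
    using sol unfolding local_solution_map_def by auto
  have fixed: "pg_map f g as (\<psi> u) u = \<psi> u" if "u \<in> U" for u
  proof -
    have "u \<in> \<Omega>" using that U by blast
    then have "C2_on UNIV f" "convex (ereal_epigraph (\<lambda>x. g (x, u)))"
      "partly_smooth_at g (M \<times> \<Omega>) (xs, u)"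
      using cpso xs by (auto simp: CPSO_def partly_smooth_def)
    then show ?thesis
      by (intro ND_imp_pg_map_fixed nd[OF that] as_pos)
         (auto simp: partly_smooth_at_def proper_fun_def)
  qed
  obtain D\<psi> where d: "(\<psi> has_derivative D\<psi>) (at us)"
    using C U(2) unfolding C1_on_def by blast
  have "((\<lambda>u. (\<psi> u, u, as)) has_derivative (\<lambda>h. (D\<psi> h, h, 0))) (at us)"
    by (auto intro!: derivative_eq_intros d)
  from has_derivative_compose[OF this] D
  have "((\<lambda>u. pg_map f g as (\<psi> u) u) has_derivative (\<lambda>h. D (D\<psi> h, h, 0))) (at us)"
    by (force simp: U(4))
  then have "(\<psi> has_derivative (\<lambda>h. D (D\<psi> h, h, 0))) (at us)"
    by (rule has_derivative_transform_within_open[OF _ U(1,2) fixed])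
  then have "(\<lambda>h. D (D\<psi> h, h, 0)) = D\<psi>" by (rule has_derivative_unique) (rule d)
  then show ?thesis using frechet_derivative_at[OF d] by metis
qed

section \<open>Convergence of the differentiated iterates\<close>

theorem mainTheorem3:
  fixes f :: "'x::euclidean_space \<times> 'u::euclidean_space \<Rightarrow> real"
    and g :: "'x \<times> 'u \<Rightarrow> ereal"
    and M :: "'x set" and \<Omega> :: "'u set"
    and L \<alpha>_lo \<alpha>_hi \<alpha>_lim \<beta>_lim :: real
    and xs x0 :: 'x and us :: 'u
    and \<alpha> \<beta> :: "nat \<Rightarrow> real"
    and V :: "(('x \<times> 'x) \<times> 'u \<times> real) set"
    and U :: "'u set" and \<psi> :: "'u \<Rightarrow> 'x"
  assumes "C2_submanifold M" and "open \<Omega>" and "0 < L"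
    and "CPSO f g M \<Omega> L"
    and "xs \<in> M" and "us \<in> \<Omega>"
    and "RPD_i f g M xs us" and "RPD_ii f M xs us" and "ND f g xs us"
    and "0 < \<alpha>_lo" and "\<alpha>_lo \<le> \<alpha>_hi" and "\<alpha>_hi < 2 / L"
    and "\<forall>k. \<alpha> k \<in> {\<alpha>_lo..\<alpha>_hi}" and "\<alpha> \<longlonglongrightarrow> \<alpha>_lim"
    and "\<forall>k. \<beta> k \<in> {0..1}" and "\<beta> \<longlonglongrightarrow> \<beta>_lim"
    and "- 1 / (1 + 2 * \<beta>_lim)
           < lambda_min (frechet_derivative (\<lambda>x. pg_map f g \<alpha>_lim x us) (at xs))"
    and "apg_neighbourhood f g M \<Omega> L xs us \<alpha>_lim V"
    and "(\<lambda>k. fst (apg f g \<alpha> \<beta> x0 us k)) \<longlonglongrightarrow> xs"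
    and "\<forall>k. (apg f g \<alpha> \<beta> x0 us k, us, \<alpha> k) \<in> V"
    and "local_solution_map f g M \<Omega> xs us U \<psi>"
  shows "\<forall>du :: 'u. (\<lambda>k. fst (apg_forward_ad f g \<alpha> \<beta> x0 us du k))
           \<longlonglongrightarrow> frechet_derivative \<psi> (at us) du"
proof
  fix du :: 'u
  note cpso = assms(4) and xsM = assms(5) and nb = assms(18) and iter = assms(19)
    and inV = assms(20) and sol = assms(21)
  let ?R = "frechet_derivative (\<lambda>x. pg_map f g \<alpha>_lim x us) (at xs)"
  obtain B c where "prox_grad_linearization ?R B c"
    using pg_map_linearization[OF assms(1,6,5) cpso assms(8,9) nb] by blast
  then interpret prox_grad_linearization ?R B c .
  have \<beta>: "0 \<le> \<beta>_lim" "\<beta>_lim \<le> 1"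
    using LIMSEQ_le_const[OF assms(16), of 0] LIMSEQ_le_const2[OF assms(16), of 1] assms(15) by auto
  have ev: "- 1 / (1 + 2 * \<beta>_lim) < l" if "v \<noteq> 0" "?R v = l *\<^sub>R v" for l v
  proof -
    have "lambda_min ?R \<le> l"
      unfolding lambda_min_def by (rule Min_le[OF finite_eigenvalues[OF linR]]) (use that in blast)
    with assms(17) show ?thesis by linarith
  qed
  define T where "T = (\<lambda>(h1, h2). ((1 + \<beta>_lim) *\<^sub>R ?R h1 - \<beta>_lim *\<^sub>R ?R h2, h1))"
  have T_pow: "(\<lambda>n. (T ^^ n) z) \<longlonglongrightarrow> 0" for z
    using two_step_operator_power_tendsto_0[OF \<beta> ev T_def] .
  have linT: "linear T"
    by (rule two_step_operator_linear[OF T_def])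
  obtain W where W: "(xs, us, \<alpha>_lim) \<in> W" and C: "C1_on W (\<lambda>(x, u, a). pg_map f g a x u)"
    by (rule apg_neighbourhood_imp_C1_pg_map[OF nb]) (rule that)
  from C obtain P where "open W"
    and P: "\<And>p. p \<in> W \<Longrightarrow> ((\<lambda>(x, u, a). pg_map f g a x u) has_derivative blinfun_apply (P p)) (at p)"
    and Pc: "continuous_on W P"
    unfolding C1_on_def by (elim conjE exE) (rule that, simp_all)
  let ?P = "P (xs, us, \<alpha>_lim)"
  have RP: "?R h = ?P (h, 0, 0)" for h
    using frechet_derivative_at[OF pg_map_partial_derivatives(1)[OF P[OF W]]] by metis
  have "0 < \<alpha>_lim" using nb by (auto simp: apg_neighbourhood_def)
  define w where "w = frechet_derivative \<psi> (at us) du"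
  have w: "?P (w, du, 0) = w"
    unfolding w_def
    by (rule solution_map_derivative_fixed_point[OF cpso xsM \<open>0 < \<alpha>_lim\<close> sol P[OF W]])

  define z where "z k = apg f g \<alpha> \<beta> x0 us k" for k
  define y where "y k = extrapolate (\<beta> k) (z k)" for k
  have fz: "(\<lambda>k. fst (z k)) \<longlonglongrightarrow> xs" using iter by (simp add: z_def)
  have "(\<lambda>k. snd (z (Suc k))) \<longlonglongrightarrow> xs"
    using fz by (simp add: z_def apg_map_def)
  then have sz: "(\<lambda>k. snd (z k)) \<longlonglongrightarrow> xs" by (rule LIMSEQ_imp_Suc)
  have "y \<longlonglongrightarrow> xs + \<beta>_lim *\<^sub>R (xs - xs)"
    unfolding y_def extrapolate_def by (intro tendsto_intros fz sz assms(16))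
  then have lim: "(\<lambda>k. (y k, us, \<alpha> k)) \<longlonglongrightarrow> (xs, us, \<alpha>_lim)"
    by (intro tendsto_intros assms(14)) simp
  \<comment> \<open>The derivative is taken at the extrapolated point. Joint continuity in the step
    size lets the moving point and the moving \<open>\<alpha> k\<close> be handled by one
    limit.\<close>
  define Q where "Q k = P (y k, us, \<alpha> k)" for k
  have evW: "\<forall>\<^sub>F k in sequentially. (y k, us, \<alpha> k) \<in> W"
    by (rule topological_tendstoD[OF lim \<open>open W\<close> W])
  have "Q \<longlonglongrightarrow> ?P"
    unfolding Q_def by (rule continuous_on_tendsto_compose[OF Pc lim W evW])
  then have Qlim: "(\<lambda>k. norm (Q k - ?P)) \<longlonglongrightarrow> 0"
    using tendsto_norm_zero LIM_zero by blast

  define dz where "dz k = apg_forward_ad f g \<alpha> \<beta> x0 us du k" for k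
  define e where "e k = dz k - (w, w)" for k
  \<comment> \<open>Three sources of error: the changed derivative on the extrapolated error, the
    changed momentum, and the changed inhomogeneity at the fixed point \<open>w\<close>. The second
    component is a pure shift and is exact.\<close>
  have step: "e (Suc k) - T (e k) =
      ((Q k - ?P) ((1 + \<beta> k) *\<^sub>R fst (e k) - \<beta> k *\<^sub>R snd (e k), 0, 0)
        + ?P ((\<beta> k - \<beta>_lim) *\<^sub>R (fst (e k) - snd (e k)), 0, 0) + (Q k - ?P) (w, du, 0), 0)"
    if kW: "(y k, us, \<alpha> k) \<in> W" for k
  proof -
    note D = pg_map_partial_derivatives[OF P[OF kW]]
    have Rk: "frechet_derivative (\<lambda>x. pg_map f g (\<alpha> k) x us) (at (y k)) h = Q k (h, 0, 0)" for h
      using frechet_derivative_at[OF D(1)] unfolding Q_def by metis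
    have Sk: "frechet_derivative (\<lambda>u. pg_map f g (\<alpha> k) (y k) u) (at us) h = Q k (0, h, 0)" for h
      using frechet_derivative_at[OF D(2)] unfolding Q_def by metis
    have "(z k, us, \<alpha> k) \<in> V" "\<beta> k \<in> {0..1}" using inV assms(15) by (auto simp: z_def)
    then have
      "frechet_derivative (\<lambda>z'. apg_map f g (\<alpha> k) (\<beta> k) z' us) (at (z k)) =
        (\<lambda>(h1, h2). ((1 + \<beta> k) *\<^sub>R Q k (h1, 0, 0) - \<beta> k *\<^sub>R Q k (h2, 0, 0), h1))"
      "frechet_derivative (\<lambda>u'. apg_map f g (\<alpha> k) (\<beta> k) (z k) u') (at us) = (\<lambda>h. (Q k (0, h, 0), 0))"
      using nb unfolding apg_neighbourhood_def Let_def Rk[symmetric] Sk[symmetric] y_def by blast+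
    then have dzS: "dz (Suc k) =
        ((1 + \<beta> k) *\<^sub>R Q k (fst (dz k), 0, 0) - \<beta> k *\<^sub>R Q k (snd (dz k), 0, 0) + Q k (0, du, 0), fst (dz k))"
      by (simp add: dz_def z_def split_beta)
    obtain a b where ab: "e k = (a, b)" by fastforce
    then have dzk: "dz k = (a + w, b + w)" by (simp add: e_def prod_eq_iff algebra_simps)
    have lin: "blinfun_apply G (u + v, 0, 0) = blinfun_apply G (u, 0, 0) + blinfun_apply G (v, 0, 0)"
      "blinfun_apply G (u - v, 0, 0) = blinfun_apply G (u, 0, 0) - blinfun_apply G (v, 0, 0)"
      "blinfun_apply G (t *\<^sub>R u, 0, 0) = t *\<^sub>R blinfun_apply G (u, 0, 0)"
      "blinfun_apply G (w, du, 0) = blinfun_apply G (w, 0, 0) + blinfun_apply G (0, du, 0)"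
      for G :: "('x \<times> 'u \<times> real) \<Rightarrow>\<^sub>L 'x" and t u v
      using blinfun.add_right[of G "(u, 0, 0)" "(v, 0, 0)"] blinfun.diff_right[of G "(u, 0, 0)" "(v, 0, 0)"]
        blinfun.scaleR_right[of G t "(u, 0, 0)"] blinfun.add_right[of G "(w, 0, 0)" "(0, du, 0)"]
      by (simp_all add: zero_prod_def)
    have w': "w = ?P (w, 0, 0) + ?P (0, du, 0)"
      using w by (simp add: lin)
    have "fst (e (Suc k) - T (e k)) = (1 + \<beta> k) *\<^sub>R Q k (a + w, 0, 0) - \<beta> k *\<^sub>R Q k (b + w, 0, 0) + Q k (0, du, 0)
        - (?P (w, 0, 0) + ?P (0, du, 0)) - ((1 + \<beta>_lim) *\<^sub>R ?P (a, 0, 0) - \<beta>_lim *\<^sub>R ?P (b, 0, 0))"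
      unfolding w'[symmetric] by (simp add: e_def[of "Suc k"] dzS dzk T_def ab RP)
    also have "\<dots> = (Q k - ?P) ((1 + \<beta> k) *\<^sub>R a - \<beta> k *\<^sub>R b, 0, 0)
        + ?P ((\<beta> k - \<beta>_lim) *\<^sub>R (a - b), 0, 0) + (Q k - ?P) (w, du, 0)"
      by (simp add: blinfun.diff_left lin algebra_simps)
    finally show ?thesis
      by (intro prod_eqI) (simp_all add: ab e_def[of "Suc k"] dzS dzk T_def)
  qed

  \<comment> \<open>The 3 bounds \<open>(1 + \<beta> k) + \<beta> k\<close>, and the 2 comes from
    the difference of the two components of \<open>e k\<close>.\<close>
  define \<eta> where "\<eta> k = 3 * norm (Q k - ?P) + norm ?P * (2 * \<bar>\<beta> k - \<beta>_lim\<bar>)" for k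
  define r where "r k = norm (Q k - ?P) * norm (w, du, 0::real)" for k
  have "\<forall>\<^sub>F k in sequentially. norm (e (Suc k) - T (e k)) \<le> \<eta> k * norm (e k) + r k"
    using evW
  proof eventually_elim
    case (elim k)
    obtain a b where ab: "e k = (a, b)" by fastforce
    have n: "norm a \<le> norm (e k)" "norm b \<le> norm (e k)"
      using norm_fst_le[of a b] norm_snd_le[of b a] by (simp_all add: ab)
    have bk: "0 \<le> \<beta> k" "\<beta> k \<le> 1" using assms(15) by (simp_all add: Ball_def)
    have "norm ((1 + \<beta> k) *\<^sub>R a - \<beta> k *\<^sub>R b) \<le> (1 + \<beta> k) * norm a + \<beta> k * norm b"
      using norm_triangle_ineq4[of "(1 + \<beta> k) *\<^sub>R a" "\<beta> k *\<^sub>R b"] bk by simp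
    also have "\<dots> \<le> 2 * norm (e k) + 1 * norm (e k)"
      using bk n by (intro add_mono mult_mono) auto
    finally have E: "norm ((1 + \<beta> k) *\<^sub>R a - \<beta> k *\<^sub>R b) \<le> 3 * norm (e k)" by simp
    have F: "norm ((\<beta> k - \<beta>_lim) *\<^sub>R (a - b)) \<le> \<bar>\<beta> k - \<beta>_lim\<bar> * (2 * norm (e k))"
      using norm_triangle_ineq4[of a b] n by (auto intro!: mult_left_mono)
    have "norm (e (Suc k) - T (e k)) =
        norm ((Q k - ?P) ((1 + \<beta> k) *\<^sub>R a - \<beta> k *\<^sub>R b, 0, 0)
        + ?P ((\<beta> k - \<beta>_lim) *\<^sub>R (a - b), 0, 0) + (Q k - ?P) (w, du, 0))"
      unfolding step[OF elim] by (simp only: ab fst_conv snd_conv norm_Pair) simp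
    also have "\<dots> \<le> norm ((Q k - ?P) ((1 + \<beta> k) *\<^sub>R a - \<beta> k *\<^sub>R b, 0, 0))
        + norm (?P ((\<beta> k - \<beta>_lim) *\<^sub>R (a - b), 0, 0)) + norm ((Q k - ?P) (w, du, 0))"
      by (rule order_trans[OF norm_triangle_ineq add_right_mono[OF norm_triangle_ineq]])
    also have "\<dots> \<le> norm (Q k - ?P) * (3 * norm (e k))
        + norm ?P * (\<bar>\<beta> k - \<beta>_lim\<bar> * (2 * norm (e k))) + norm (Q k - ?P) * norm (w, du, 0::real)"
    proof (intro add_mono)
      show "norm ((Q k - ?P) ((1 + \<beta> k) *\<^sub>R a - \<beta> k *\<^sub>R b, 0, 0)) \<le> norm (Q k - ?P) * (3 * norm (e k))"
        using norm_blinfun[of "Q k - ?P" "((1 + \<beta> k) *\<^sub>R a - \<beta> k *\<^sub>R b, 0, 0)"]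
          mult_left_mono[OF E norm_ge_zero[of "Q k - ?P"]] by (simp add: norm_Pair)
      show "norm (?P ((\<beta> k - \<beta>_lim) *\<^sub>R (a - b), 0, 0))
          \<le> norm ?P * (\<bar>\<beta> k - \<beta>_lim\<bar> * (2 * norm (e k)))"
        using norm_blinfun[of ?P "((\<beta> k - \<beta>_lim) *\<^sub>R (a - b), 0, 0)"]
          mult_left_mono[OF F norm_ge_zero[of ?P]] by (simp add: norm_Pair)
      show "norm ((Q k - ?P) (w, du, 0)) \<le> norm (Q k - ?P) * norm (w, du, 0::real)"
        by (rule norm_blinfun)
    qed
    also have "\<dots> = \<eta> k * norm (e k) + r k" by (simp add: \<eta>_def r_def algebra_simps)
    finally show ?case .
  qed
  moreover have "\<eta> \<longlonglongrightarrow> 3 * 0 + norm ?P * (2 * \<bar>\<beta>_lim - \<beta>_lim\<bar>)"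
    unfolding \<eta>_def by (intro tendsto_intros Qlim assms(16))
  then have "\<eta> \<longlonglongrightarrow> 0" by simp
  moreover have "r \<longlonglongrightarrow> 0" unfolding r_def by (rule tendsto_mult_left_zero[OF Qlim])
  ultimately have "e \<longlonglongrightarrow> 0"
    by (rule perturbed_linear_iteration_tendsto_0[OF linT T_pow])
  from tendsto_add[OF tendsto_fst[OF this] tendsto_const[of w]]
  have "(\<lambda>k. fst (e k) + w) \<longlonglongrightarrow> w" by simp
  then show "(\<lambda>k. fst (apg_forward_ad f g \<alpha> \<beta> x0 us du k)) \<longlonglongrightarrow> frechet_derivative \<psi> (at us) du"
    by (simp add: e_def dz_def w_def)
qed

end
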